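(* There are negative examples $(G,H)$ to the Neumanns' Problem in which $H$ is infinite. For instance, $G = \mathrm{PSL}(2,\mathbb{Z})$ and $H = \mathrm{PSL}(2,5) \times G/G''$ yield such an example: $H$ is a homomorphic image of $G$ (and $H$ is infinite), but $H$ admits generating pairs $(h_1,h_2)$ that do not lift to generating pairs of $G$ along any homomorphism, i.e., for all homomorphisms $\vartheta \colon G \to H$ and all generating pairs $(g_1,g_2)$ of $G$ one has $(g_1^{\,\vartheta},g_2^{\,\vartheta}) \ne (h_1,h_2)$.
   Context: Neumanns' Problem: Suppose that $G$ is a group which can be generated by $n$ elements and let $H$ be a homomorphic image of $G$. Does there exist, for every generating $n$-tuple $(h_1,\ldots,h_n)$ of $H$, a homomorphism $\vartheta \colon G \to H$ and a generating $n$-tuple $(g_1,\ldots,g_n)$ of $G$ such that $(g_1^{\,\vartheta},\ldots,g_n^{\,\vartheta}) = (h_1,\ldots,h_n)$? A negative example $(G,H)$ (here for $n=2$) is a pair consisting of a $2$-generated group $G$ and a homomorphic image $H$ of $G$ for which the answer is no. $G'' = (G')'$ denotes the second derived subgroup of $G$; $\mathrm{PSL}(2,\mathbb{Z}) = \mathrm{SL}(2,\mathbb{Z})/\{\pm I\}$ and $\mathrm{PSL}(2,5) = \mathrm{SL}(2,\mathbb{F}_5)/\{\pm I\}$. Homomorphisms are written on the right: $g^{\vartheta}$ is the image of $g$ under $\vartheta$. *)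

theory Defs
  imports
    "HOL-Analysis.Determinants"
    "HOL-Library.Numeral_Type"
    "HOL-Algebra.Generated_Groups"
begin

definition SL2 :: "'a::comm_ring_1 itself \<Rightarrow> ('a ^ 2 ^ 2) monoid"
  where "SL2 _ = \<lparr>carrier = {A. det A = 1}, monoid.mult = (**), one = mat 1\<rparr>"

text \<open>
  The elements of the following group are the cosets of \<open>{I, -I}\<close>. The field with five elements
  is the numeral type \<open>5\<close>, whose ring structure is that of the integers modulo 5.
\<close>

definition PSL2 :: "'a::comm_ring_1 itself \<Rightarrow> ('a ^ 2 ^ 2) set monoid"
  where "PSL2 R = SL2 R Mod {mat 1, - mat 1}"

lemma group_SL2: "group (SL2 TYPE('a::comm_ring_1))"
proof (rule groupI)
  fix A assume A: "A \<in> carrier (SL2 TYPE('a))"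
  define B :: "'a ^ 2 ^ 2"
    where "B = (\<chi> i j. if i = j then A $ (if i = 1 then 2 else 1) $ (if i = 1 then 2 else 1)
                       else - A $ i $ j)"
  have "det B = 1" "B ** A = mat 1"
    using A by (auto simp: B_def SL2_def det_2 matrix_matrix_mult_def mat_def vec_eq_iff
        sum_2 forall_2 algebra_simps)
  then show "\<exists>B\<in>carrier (SL2 TYPE('a)). B \<otimes>\<^bsub>SL2 TYPE('a)\<^esub> A = \<one>\<^bsub>SL2 TYPE('a)\<^esub>"
    by (auto simp: SL2_def)
qed (auto simp: SL2_def det_mul matrix_mul_assoc)

lemma normal_SL2: "{mat 1, - mat 1} \<lhd> SL2 TYPE('a::comm_ring_1)"
proof -
  interpret group "SL2 TYPE('a)" by (rule group_SL2)
  have neg: "- mat 1 \<in> carrier (SL2 TYPE('a))"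
    by (simp add: SL2_def det_2 mat_def)
  have comm: "A ** (- mat 1) = - A" "(- mat 1) ** A = - A" for A :: "'a ^ 2 ^ 2"
    by (simp_all add: matrix_matrix_mult_def mat_def vec_eq_iff sum_2 forall_2)
  have inv_neg: "inv\<^bsub>SL2 TYPE('a)\<^esub> (- mat 1) = - mat 1"
    by (rule inv_equality) (use neg comm in \<open>auto simp: SL2_def\<close>)
  have inv_one': "inv\<^bsub>SL2 TYPE('a)\<^esub> (mat 1) = mat 1"
    using inv_one by (simp add: SL2_def)
  have "subgroup {mat 1, - mat 1} (SL2 TYPE('a))"
    by (rule subgroupI) (use neg inv_neg inv_one' comm in \<open>auto simp: SL2_def\<close>)
  then show ?thesis
    by (rule normalI) (auto simp: r_coset_def l_coset_def SL2_def comm)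
qed

lemma group_PSL2: "group (PSL2 TYPE('a::comm_ring_1))"
  unfolding PSL2_def by (rule normal.factorgroup_is_group[OF normal_SL2])

definition second_derived :: "('a, 'b) monoid_scheme \<Rightarrow> 'a set"
  where "second_derived G = derived G (derived G (carrier G))"

definition generating_tuple :: "('a, 'b) monoid_scheme \<Rightarrow> nat \<Rightarrow> 'a list \<Rightarrow> bool"
  where "generating_tuple G n gs \<longleftrightarrow>
    length gs = n \<and> set gs \<subseteq> carrier G \<and> generate G (set gs) = carrier G"

text \<open>
  A pair \<open>(G, H)\<close> satisfying the hypotheses of the Neumanns' Problem for \<open>n\<close>, for which the answer
  to the problem is no. Since a function is applied on the left here, \<open>map \<theta> gs\<close> is the
  tuple of the images of the entries of \<open>gs\<close> under \<open>\<theta>\<close>.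
\<close>

definition neumann_negative_example ::
    "nat \<Rightarrow> ('a, 'c) monoid_scheme \<Rightarrow> ('b, 'd) monoid_scheme \<Rightarrow> bool"
  where "neumann_negative_example n G H \<longleftrightarrow>
    group G \<and> group H \<and>
    (\<exists>gs. generating_tuple G n gs) \<and>
    epi G H \<noteq> {} \<and>
    (\<exists>hs. generating_tuple H n hs \<and>
      (\<forall>\<theta>\<in>hom G H. \<forall>gs. generating_tuple G n gs \<longrightarrow> map \<theta> gs \<noteq> hs))"

end

theory Submission
  imports Defs
begin

text \<open>
  For \<open>A\<close> and \<open>B\<close> of determinant 1 the matrix \<open>A B A\<^sup>-\<^sup>1 B\<^sup>-\<^sup>1\<close> is unchanged when the sign of \<open>A\<close> or \<open>B\<close>
  changes, so a pair of elements of a group \<open>PSL(2, R)\<close> has a well-defined commutator in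
  \<open>SL(2, R)\<close>, and the trace of this commutator is an invariant of the pair.

  If \<open>A\<close> and \<open>B\<close> generate \<open>PSL(2, \<int>)\<close>, this trace is 3. Indeed the left ideal of the ring of integer
  matrices generated by \<open>A B - B A\<close> contains \<open>X Y - Y X\<close> for all \<open>X\<close> and \<open>Y\<close> in \<open>SL(2, \<int>)\<close>
  (\<open>commutator_ideal\<close>). One of these differences has determinant \<open>-1\<close>, so \<open>A B - B A\<close> has
  determinant 1 or \<open>-1\<close>, and the trace of the commutator, which is \<open>2 - det (A B - B A)\<close>, is 1 or 3.
  The value 1 would give a solution of \<open>x\<^sup>2 + y\<^sup>2 + z\<^sup>2 - x y z = 3\<close>, and there is none modulo 9.
  Moreover all matrices of trace 3 in \<open>SL(2, \<int>)\<close> are conjugate (\<open>trace_3_conjugate\<close>). Hence the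
  commutator of every generating pair is conjugate to the commutator of the standard generators
  \<open>a\<close> of order 2 and \<open>b\<close> of order 3.

  Now let a homomorphism from \<open>PSL(2, \<int>)\<close> to \<open>PSL(2, 5)\<close> map some generating pair to the classes of
  \<open>(1 1; 0 1)\<close> and \<open>(1 0; 2 1)\<close>. These generate \<open>PSL(2, 5)\<close>, and their commutator has trace 1. So the
  images \<open>\<alpha>\<close>, \<open>\<beta>\<close> of \<open>a\<close>, \<open>b\<close> have a commutator of trace 1 or \<open>-1\<close>. In
  particular \<open>\<alpha>\<close> and \<open>\<beta>\<close> do not commute, so they have orders 2 and 3, which forces the traces 0 and
  \<open>\<plusminus>1\<close>. By Fricke's identity that commutator has trace \<open>z\<^sup>2 - 1\<close> where \<open>z\<close> is the trace of \<open>\<alpha> \<beta>\<close>. The number 2 is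
  not a square modulo 5, so \<open>z = 0\<close>, which means that \<open>\<alpha>\<close> inverts \<open>\<beta>\<close>. The image of the homomorphism
  is then dihedral, and it cannot contain generators of \<open>PSL(2, 5)\<close>
  (\<open>no_generating_pair_over_upper_lower\<close>).

  The second factor \<open>G/G''\<close> makes \<open>H\<close> infinite: \<open>G\<close> is the free product of \<open>\<langle>a\<rangle>\<close> and \<open>\<langle>b\<rangle>\<close>, so it maps onto
  an infinite group generated by two rotations of the complex plane, of orders 2 and 3, and such a
  group is metabelian (\<open>infinite_PSL2_int_quotient\<close>). Since \<open>PSL(2, 5)\<close> is perfect and \<open>G/G''\<close> is
  metabelian, a subgroup of the product is everything as soon as it projects onto both factors
  (\<open>subdirect_perfect_metabelian\<close>). This shows both that \<open>G\<close> maps onto \<open>H\<close> and that any two generating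
  pairs of the factors combine to a generating pair of \<open>H\<close>, so the pair of \<open>PSL(2, 5)\<close> above extends
  to one of \<open>H\<close>.
\<close>

section \<open>Matrices of size two\<close>

definition mat2 :: "'a \<Rightarrow> 'a \<Rightarrow> 'a \<Rightarrow> 'a \<Rightarrow> 'a ^ 2 ^ 2"
  where "mat2 a b c d = (\<chi> i j. if i = 1 then (if j = 1 then a else b) else (if j = 1 then c else d))"

lemma mat2_nth [simp]:
  "mat2 a b c d $ 1 $ 1 = a" "mat2 a b c d $ 1 $ 2 = b"
  "mat2 a b c d $ 2 $ 1 = c" "mat2 a b c d $ 2 $ 2 = d"
  by (simp_all add: mat2_def)

lemma mat2_eq_iff [simp]:
  "mat2 a b c d = mat2 a' b' c' d' \<longleftrightarrow> a = a' \<and> b = b' \<and> c = c' \<and> d = d'"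
  by (auto simp: vec_eq_iff forall_2)

lemma mat2_exhaust: obtains a b c d where "A = mat2 a b c d"
proof
  show "A = mat2 (A $ 1 $ 1) (A $ 1 $ 2) (A $ 2 $ 1) (A $ 2 $ 2)"
    by (simp add: vec_eq_iff forall_2)
qed

definition adj2 :: "'a::comm_ring_1 ^ 2 ^ 2 \<Rightarrow> 'a ^ 2 ^ 2"
  where "adj2 A = mat2 (A $ 2 $ 2) (- (A $ 1 $ 2)) (- (A $ 2 $ 1)) (A $ 1 $ 1)"

text \<open>
  Together with \<open>mat2_exhaust\<close> and \<open>mat2_eq_iff\<close>, these rules turn a matrix identity into
  polynomial identities between the entries.
\<close>

lemma mat2_arith:
  fixes a b c d :: "'a::comm_ring_1"
  shows "mat2 a b c d + mat2 a' b' c' d' = mat2 (a + a') (b + b') (c + c') (d + d')"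
    "mat2 a b c d - mat2 a' b' c' d' = mat2 (a - a') (b - b') (c - c') (d - d')"
    "- mat2 a b c d = mat2 (- a) (- b) (- c) (- d)"
    "mat2 a b c d ** mat2 a' b' c' d' =
      mat2 (a * a' + b * c') (a * b' + b * d') (c * a' + d * c') (c * b' + d * d')"
    "det (mat2 a b c d) = a * d - b * c"
    "trace (mat2 a b c d) = a + d"
    "adj2 (mat2 a b c d) = mat2 d (- b) (- c) a"
    "mat 1 = mat2 1 0 0 (1::'a)"
    "0 = mat2 0 0 0 (0::'a)"
  by (simp_all add: vec_eq_iff forall_2 matrix_matrix_mult_def sum_2 det_2 trace_def mat_def adj2_def)

lemma det_adj2 [simp]: "det (adj2 A) = det A"
  by (rule mat2_exhaust[of A]) (simp add: mat2_arith algebra_simps)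

lemma adj2_mult: "adj2 (A ** B) = adj2 B ** adj2 A"
  by (rule mat2_exhaust[of A], rule mat2_exhaust[of B]) (simp add: mat2_arith algebra_simps)

lemma adj2_inverse: "det A = 1 \<Longrightarrow> A ** adj2 A = mat 1" "det A = 1 \<Longrightarrow> adj2 A ** A = mat 1"
  by (rule mat2_exhaust[of A]; simp add: mat2_arith algebra_simps)+

lemma matrix_mult_minus:
  fixes A B :: "'a::comm_ring_1 ^ 2 ^ 2"
  shows "(- A) ** B = - (A ** B)" "A ** (- B) = - (A ** B)"
  by (rule mat2_exhaust[of A], rule mat2_exhaust[of B], simp add: mat2_arith algebra_simps)+

lemma det_minus [simp]: "det (- A) = det (A :: 'a::comm_ring_1 ^ 2 ^ 2)"
  by (rule mat2_exhaust[of A]) (simp add: mat2_arith algebra_simps)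

lemma trace_minus: "trace (- A) = - trace (A :: 'a::comm_ring_1 ^ 2 ^ 2)"
  by (rule mat2_exhaust[of A]) (simp add: mat2_arith algebra_simps)

text \<open>
  The adjugate stands for the inverse, which it equals when the determinant is 1.
\<close>

definition commutator :: "'a::comm_ring_1 ^ 2 ^ 2 \<Rightarrow> 'a ^ 2 ^ 2 \<Rightarrow> 'a ^ 2 ^ 2"
  where "commutator A B = A ** B ** adj2 A ** adj2 B"

lemma det_commutator: "det A = 1 \<Longrightarrow> det B = 1 \<Longrightarrow> det (commutator A B) = 1"
  by (simp add: commutator_def det_mul)

lemma det_commutator_diff:
  fixes A B :: "'a::comm_ring_1 ^ 2 ^ 2"
  shows "det (A ** B - B ** A) = 4 * det A * det B - (trace A)\<^sup>2 * det B - (trace B)\<^sup>2 * det A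
    - (trace (A ** B))\<^sup>2 + trace A * trace B * trace (A ** B)"
  by (rule mat2_exhaust[of A], rule mat2_exhaust[of B])
     (simp add: mat2_arith power2_eq_square algebra_simps)

text \<open>
  Subtracting the identity from the commutator gives \<open>(A B - B A) (B A)\<^sup>-\<^sup>1\<close>, and
  \<open>det (X - I) = 2 - trace X\<close> when \<open>X\<close> has determinant 1.
\<close>

lemma trace_commutator_det:
  fixes A B :: "'a::comm_ring_1 ^ 2 ^ 2"
  assumes "det A = 1" "det B = 1"
  shows "trace (commutator A B) = 2 - det (A ** B - B ** A)"
proof -
  have distrib: "(X - Y) ** Z = X ** Z - Y ** Z" for X Y Z :: "'a ^ 2 ^ 2"
    by (rule mat2_exhaust[of X], rule mat2_exhaust[of Y], rule mat2_exhaust[of Z])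
       (simp add: mat2_arith algebra_simps)
  have "B ** A ** adj2 A ** adj2 B = mat 1"
    using assms by (metis adj2_inverse(1) matrix_mul_assoc matrix_mul_rid)
  then have "commutator A B - mat 1 = (A ** B - B ** A) ** adj2 (B ** A)"
    by (simp add: commutator_def distrib adj2_mult matrix_mul_assoc)
  then have "det (commutator A B - mat 1) = det (A ** B - B ** A)"
    using assms by (simp add: det_mul)
  moreover have "det (X - mat 1) = det X - trace X + 1" for X :: "'a ^ 2 ^ 2"
    by (rule mat2_exhaust[of X]) (simp add: mat2_arith algebra_simps)
  ultimately show ?thesis
    using det_commutator[OF assms] by (simp add: algebra_simps)
qed

text \<open>
  Fricke's identity.
\<close>

lemma trace_commutator:
  fixes A B :: "'a::comm_ring_1 ^ 2 ^ 2"
  assumes "det A = 1" "det B = 1"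
  shows "trace (commutator A B) =
    (trace A)\<^sup>2 + (trace B)\<^sup>2 + (trace (A ** B))\<^sup>2 - trace A * trace B * trace (A ** B) - 2"
  using assms by (simp add: trace_commutator_det det_commutator_diff)

lemma trace_commutator_commuting:
  assumes "det A = 1" "det B = 1" "A ** B = B ** (A :: 'a::comm_ring_1 ^ 2 ^ 2)"
  shows "trace (commutator A B) = 2"
  using assms by (simp add: trace_commutator_det mat2_arith)

section \<open>The elements of PSL(2, R)\<close>

definition proj :: "'a::comm_ring_1 ^ 2 ^ 2 \<Rightarrow> ('a ^ 2 ^ 2) set"
  where "proj A = {A, - A}"

lemma proj_eq_iff: "proj A = proj B \<longleftrightarrow> A = B \<or> A = - B"
  unfolding proj_def by (auto simp: doubleton_eq_iff)

lemma proj_minus [simp]: "proj (- A) = proj A"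
  by (auto simp: proj_def)

lemma coset_eq_proj: "{mat 1, - mat 1} #>\<^bsub>SL2 TYPE('a::comm_ring_1)\<^esub> A = proj A"
  by (auto simp: r_coset_def SL2_def proj_def matrix_mult_minus)

lemma carrier_PSL2: "carrier (PSL2 TYPE('a::comm_ring_1)) = proj ` {A. det A = 1}"
  unfolding PSL2_def carrier_FactGroup coset_eq_proj by (simp add: SL2_def)

lemma proj_in_carrier [intro, simp]:
  "det A = 1 \<Longrightarrow> proj A \<in> carrier (PSL2 TYPE('a::comm_ring_1))"
  by (simp add: carrier_PSL2)

lemma PSL2_exhaust:
  assumes "g \<in> carrier (PSL2 TYPE('a::comm_ring_1))"
  obtains A where "det A = 1" "g = proj A"
  using assms by (auto simp: carrier_PSL2)

lemma proj_mult [simp]: "proj A \<otimes>\<^bsub>PSL2 TYPE('a::comm_ring_1)\<^esub> proj B = proj (A ** B)"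
  by (auto simp: PSL2_def set_mult_def SL2_def proj_def matrix_mult_minus)

lemma one_PSL2: "\<one>\<^bsub>PSL2 TYPE('a::comm_ring_1)\<^esub> = proj (mat 1)"
  by (simp add: PSL2_def proj_def)

lemma proj_eq_one_iff: "proj A = \<one>\<^bsub>PSL2 TYPE('a::comm_ring_1)\<^esub> \<longleftrightarrow> A = mat 1 \<or> A = - mat 1"
  by (simp add: one_PSL2 proj_eq_iff)

lemma proj_inv [simp]:
  "det A = 1 \<Longrightarrow> inv\<^bsub>PSL2 TYPE('a::comm_ring_1)\<^esub> (proj A) = proj (adj2 A)"
  by (rule group.inv_equality[OF group_PSL2]) (simp_all add: adj2_inverse one_PSL2)

text \<open>
  Generation modulo sign is as good as generation of \<open>SL(2, R)\<close> for properties that do not depend on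
  the sign.
\<close>

lemma PSL2_generate_induct [consumes 4, case_names one fst snd inv_fst inv_snd minus mult]:
  fixes A B X :: "'a::comm_ring_1 ^ 2 ^ 2"
  assumes gen: "generate (PSL2 TYPE('a)) {proj A, proj B} = carrier (PSL2 TYPE('a))"
    and det: "det A = 1" "det B = 1" "det X = 1"
    and P: "P (mat 1)" "P A" "P B" "P (adj2 A)" "P (adj2 B)"
    and minus: "\<And>X. P X \<Longrightarrow> P (- X)"
    and mult: "\<And>X Y. det X = 1 \<Longrightarrow> det Y = 1 \<Longrightarrow> P X \<Longrightarrow> P Y \<Longrightarrow> P (X ** Y)"
  shows "P X"
proof -
  have "\<exists>Y. g = proj Y \<and> det Y = 1 \<and> P Y"
    if "g \<in> generate (PSL2 TYPE('a)) {proj A, proj B}" for g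
    using that
  proof induction
    case (eng g h)
    then show ?case using mult by (metis det_mul mult_1 proj_mult)
  qed (use P det one_PSL2 in \<open>force+\<close>)
  then have "\<exists>Y. proj X = proj Y \<and> P Y"
    using gen det by blast
  then show ?thesis using minus by (auto simp: proj_eq_iff)
qed

section \<open>Subdirect products and second derived subgroups\<close>

text \<open>
  The second derived subgroup of \<open>K\<close> still projects onto \<open>P\<close>, because \<open>P\<close> is perfect, but it projects
  to the identity of \<open>Q\<close>. So it is the first factor, and \<open>K\<close> is a union of its cosets.
\<close>

lemma subdirect_perfect_metabelian:
  assumes P: "group P" and Q: "group Q"
    and perfect: "derived P (carrier P) = carrier P"
    and metabelian: "second_derived Q = {\<one>\<^bsub>Q\<^esub>}"
    and K: "subgroup K (P \<times>\<times> Q)"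
    and fst: "fst ` K = carrier P" and snd: "snd ` K = carrier Q"
  shows "K = carrier (P \<times>\<times> Q)"
proof -
  interpret P: group P by fact
  interpret Q: group Q by fact
  interpret PQ: group "P \<times>\<times> Q" by (rule DirProd_group) fact+
  interpret K: subgroup K "P \<times>\<times> Q" by fact
  interpret fst: group_hom "P \<times>\<times> Q" P fst
    by unfold_locales (auto simp: hom_def)
  interpret snd: group_hom "P \<times>\<times> Q" Q snd
    by unfold_locales (auto simp: hom_def)
  define D where "D = derived (P \<times>\<times> Q) (derived (P \<times>\<times> Q) K)"
  have sub: "K \<subseteq> carrier (P \<times>\<times> Q)" by (rule K.subset)
  have sub': "derived (P \<times>\<times> Q) K \<subseteq> carrier (P \<times>\<times> Q)" using PQ.derived_in_carrier[OF sub] .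
  have "D \<subseteq> K"
    unfolding D_def using PQ.derived_incl[OF PQ.derived_incl[OF order_refl K] K] .
  have "fst ` D = carrier P"
    unfolding D_def using fst.derived_img[OF sub'] fst.derived_img[OF sub] perfect
    by (simp add: assms(6))
  have "snd ` D = {\<one>\<^bsub>Q\<^esub>}"
    unfolding D_def using snd.derived_img[OF sub'] snd.derived_img[OF sub] metabelian
    by (simp add: assms(7) second_derived_def)
  \<comment> \<open>An element of the second derived subgroup of \<open>K\<close> has trivial second component, while its
    first component can be prescribed; so \<open>K\<close> contains the whole first factor.\<close>
  have left: "(x, \<one>\<^bsub>Q\<^esub>) \<in> K" if "x \<in> carrier P" for x
  proof -
    from that obtain d where d: "d \<in> D" "fst d = x"
      unfolding \<open>fst ` D = carrier P\<close>[symmetric] by blast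
    have "snd d \<in> {\<one>\<^bsub>Q\<^esub>}"
      unfolding \<open>snd ` D = {\<one>\<^bsub>Q\<^esub>}\<close>[symmetric] using d(1) by (rule imageI)
    then have "d = (x, \<one>\<^bsub>Q\<^esub>)" using d(2) by (simp add: prod_eq_iff)
    then show ?thesis using d(1) \<open>D \<subseteq> K\<close> by blast
  qed
  have "(x, y) \<in> K" if x: "x \<in> carrier P" and y: "y \<in> carrier Q" for x y
  proof -
    from y obtain d where "d \<in> K" "snd d = y" unfolding snd[symmetric] by blast
    then obtain x' where x': "(x', y) \<in> K" by (cases d) auto
    then have "x' \<in> carrier P" using sub by auto
    then have "(x \<otimes>\<^bsub>P\<^esub> inv\<^bsub>P\<^esub> x', \<one>\<^bsub>Q\<^esub>) \<otimes>\<^bsub>P \<times>\<times> Q\<^esub> (x', y) \<in> K"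
      using x by (intro K.m_closed left x') simp
    then show ?thesis using x y \<open>x' \<in> carrier P\<close> by (simp add: P.m_assoc)
  qed
  with sub show ?thesis by auto
qed

lemma (in group) second_derived_normal: "second_derived G \<lhd> G"
  unfolding second_derived_def by (intro derived_is_normal normal_self)

lemma (in group) second_derived_quotient:
  "second_derived (G Mod second_derived G) = {\<one>\<^bsub>G Mod second_derived G\<^esub>}"
proof -
  interpret N: normal "second_derived G" G by (rule second_derived_normal)
  interpret Q: group "G Mod second_derived G" by (rule N.factorgroup_is_group)
  interpret q: group_hom G "G Mod second_derived G" "\<lambda>g. second_derived G #> g"
    by unfold_locales (rule N.r_coset_hom_Mod)
  have "second_derived (G Mod second_derived G) = (\<lambda>g. second_derived G #> g) ` second_derived G"
    unfolding second_derived_def[of "G Mod second_derived G"] carrier_FactGroup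
    by (subst q.derived_img, simp, subst q.derived_img)
       (simp_all add: derived_in_carrier second_derived_def)
  also have "\<dots> = {second_derived G}"
    using N.subgroup_axioms N.one_closed coset_join2 N.subset by (auto simp: image_iff) (metis N.one_closed)+
  finally show ?thesis by simp
qed

lemma (in group_hom) hom_second_derived: "h ` second_derived G \<subseteq> second_derived H"
proof -
  have "h ` second_derived G = derived H (derived H (h ` carrier G))"
    unfolding second_derived_def by (simp add: derived_img G.derived_in_carrier)
  also have "\<dots> \<subseteq> second_derived H"
    unfolding second_derived_def by (intro H.mono_derived) auto
  finally show ?thesis .
qed

text \<open>
  A homomorphism to a metabelian group factors through the quotient by the second derived subgroup.
\<close>

lemma infinite_quotient_second_derived:
  assumes hom: "group_hom G H h" and metabelian: "second_derived H = {\<one>\<^bsub>H\<^esub>}"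
    and infinite: "infinite (h ` carrier G)"
  shows "infinite (carrier (G Mod second_derived G))"
proof
  interpret group_hom G H h by fact
  assume "finite (carrier (G Mod second_derived G))"
  have kernel: "h x = h y"
    if "x \<in> carrier G" "y \<in> carrier G" "second_derived G #>\<^bsub>G\<^esub> x = second_derived G #>\<^bsub>G\<^esub> y" for x y
  proof -
    have "x \<in> second_derived G #>\<^bsub>G\<^esub> y"
      using that G.rcos_self G.second_derived_normal normal_imp_subgroup by metis
    then obtain d where "d \<in> second_derived G" "x = d \<otimes>\<^bsub>G\<^esub> y" by (auto simp: r_coset_def)
    moreover have "h d = \<one>\<^bsub>H\<^esub>" using hom_second_derived metabelian calculation(1) by auto
    moreover have "d \<in> carrier G"
      using calculation(1) G.second_derived_normal normal.axioms(1) subgroup.subset by blast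
    ultimately show ?thesis using that by simp
  qed
  obtain f where f: "\<And>x. x \<in> carrier G \<Longrightarrow> f (second_derived G #>\<^bsub>G\<^esub> x) = h x"
    using FactGroup_universal[OF homh G.second_derived_normal kernel] by blast
  have "h ` carrier G = f ` carrier (G Mod second_derived G)"
    unfolding carrier_FactGroup image_image using f by (intro image_cong) auto
  with infinite \<open>finite _\<close> show False by simp
qed

section \<open>The modular group as a free product\<close>

text \<open>
  In \<open>PSL(2, \<int>)\<close> the classes of these matrices have orders 2 and 3.
\<close>

abbreviation (input) ord2 :: "int ^ 2 ^ 2" where "ord2 \<equiv> mat2 0 (- 1) 1 0"

abbreviation (input) ord3 :: "int ^ 2 ^ 2" where "ord3 \<equiv> mat2 0 (- 1) 1 1"

text \<open>
  The product of the two given elements is the translation \<open>(1 1; 0 1)\<close>. Euclid's algorithm on the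
  first column writes every matrix of determinant 1 as a product of translations and the matrix of
  order 2.
\<close>

lemma PSL2_int_subgroup_eq:
  assumes K: "subgroup K (PSL2 TYPE(int))" and mem: "proj ord2 \<in> K" "proj ord3 \<in> K"
  shows "K = carrier (PSL2 TYPE(int))"
proof -
  interpret K: subgroup K "PSL2 TYPE(int)" by fact
  have m: "proj (A ** B) \<in> K" if "proj A \<in> K" "proj B \<in> K" for A B
    using K.m_closed[OF that] by simp
  have T: "proj (mat2 1 1 0 1) \<in> K"
    using m[OF mem] by (simp add: mat2_arith proj_def insert_commute)
  have T': "proj (mat2 1 (- 1) 0 1) \<in> K"
    using K.m_inv_closed[OF T] by (simp add: mat2_arith)
  have transl_nat: "proj (mat2 1 (int n) 0 1) \<in> K \<and> proj (mat2 1 (- int n) 0 1) \<in> K" for n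
  proof (induction n)
    case 0
    then show ?case using K.one_closed by (simp add: one_PSL2 mat2_arith)
  next
    case (Suc n)
    then show ?case using m[OF T, of "mat2 1 (int n) 0 1"] m[OF T', of "mat2 1 (- int n) 0 1"]
      by (simp add: mat2_arith algebra_simps)
  qed
  have transl: "proj (mat2 1 n 0 1) \<in> K" for n
    using transl_nat[of "nat \<bar>n\<bar>"] by (cases "n \<ge> 0") auto
  have "proj (mat2 a b c d) \<in> K" if "a * d - b * c = 1" for a b c d
    using that
  proof (induction "nat \<bar>c\<bar>" arbitrary: a b c d rule: less_induct)
    case less
    show ?case
    proof (cases "c = 0")
      \<comment> \<open>A matrix of determinant 1 with lower left entry 0 is a translation up to sign.\<close>
      case True
      with less.prems have "a = 1 \<and> d = 1 \<or> a = - 1 \<and> d = - 1"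
        by (auto simp: zmult_eq_1_iff)
      then have "proj (mat2 a b c d) = proj (mat2 1 (a * b) 0 1)"
        using True by (auto simp: proj_eq_iff mat2_arith)
      then show ?thesis using transl by simp
    next
      case False
      \<comment> \<open>Multiplying on the left by the translation by \<open>-q\<close> replaces \<open>a\<close> by the remainder \<open>r\<close>; the
        matrix of order 2 then moves it to the lower left corner.\<close>
      define q r where "q = a div c" and "r = a mod c"
      have a: "a = q * c + r" by (simp add: q_def r_def)
      have "\<bar>r\<bar> < \<bar>c\<bar>" unfolding r_def by (rule abs_mod_less[OF False])
      then have "proj (mat2 c d (- r) (q * d - b)) \<in> K"
        using False by (intro less.hyps) (use less.prems in \<open>auto simp: a algebra_simps\<close>)
      from m[OF transl[of q] m[OF mem(1) this]] show ?thesis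
        by (simp add: mat2_arith a algebra_simps)
    qed
  qed
  then have "carrier (PSL2 TYPE(int)) \<subseteq> K"
    unfolding carrier_PSL2 by (metis (mono_tags, lifting) image_subsetI mat2_arith(5) mat2_exhaust mem_Collect_eq)
  with K.subset show ?thesis by blast
qed

lemma PSL2_int_generate: "generate (PSL2 TYPE(int)) {proj ord2, proj ord3} = carrier (PSL2 TYPE(int))"
proof (rule PSL2_int_subgroup_eq)
  show "subgroup (generate (PSL2 TYPE(int)) {proj ord2, proj ord3}) (PSL2 TYPE(int))"
    by (rule group.generate_is_subgroup[OF group_PSL2]) (auto simp: mat2_arith)
qed (auto intro: generate.incl)

text \<open>
  Up to sign, \<open>(1 1; 0 1)\<close> is \<open>a b\<close> and \<open>(1 0; 1 1)\<close> is \<open>a b\<^sup>-\<^sup>1\<close>, where \<open>a\<close> is \<open>ord2\<close> and \<open>b\<close> is \<open>ord3\<close>.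
  The set consists of the products of these two matrices, each paired with the value in \<open>K\<close> of the
  same word in \<open>x\<close> and \<open>y\<close>; for \<open>b\<^sup>-\<^sup>1 = b\<^sup>2\<close> the value is \<open>y\<^sup>2\<close>.
\<close>

inductive_set positive_words :: "('k, 'm) monoid_scheme \<Rightarrow> 'k \<Rightarrow> 'k \<Rightarrow> ((int ^ 2 ^ 2) \<times> 'k) set"
  for K x y where
    one: "(mat 1, \<one>\<^bsub>K\<^esub>) \<in> positive_words K x y"
  | upper: "(P, k) \<in> positive_words K x y \<Longrightarrow>
      (mat2 1 1 0 1 ** P, x \<otimes>\<^bsub>K\<^esub> (y \<otimes>\<^bsub>K\<^esub> k)) \<in> positive_words K x y"
  | lower: "(P, k) \<in> positive_words K x y \<Longrightarrow>
      (mat2 1 0 1 1 ** P, x \<otimes>\<^bsub>K\<^esub> (y \<otimes>\<^bsub>K\<^esub> (y \<otimes>\<^bsub>K\<^esub> k))) \<in> positive_words K x y"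

text \<open>
  The entries never decrease, and the first factor makes an off-diagonal entry positive. So only the
  empty word represents the identity.
\<close>

lemma positive_words_shape:
  assumes "(P, k) \<in> positive_words K x y"
  obtains p q r s where "P = mat2 p q r s" "p \<ge> 1" "q \<ge> 0" "r \<ge> 0" "s \<ge> 1"
    "k = \<one>\<^bsub>K\<^esub> \<or> q + r \<ge> 1"
proof -
  have "\<exists>p q r s. P = mat2 p q r s \<and> p \<ge> 1 \<and> q \<ge> 0 \<and> r \<ge> 0 \<and> s \<ge> 1 \<and> (k = \<one>\<^bsub>K\<^esub> \<or> q + r \<ge> 1)"
    using assms
  proof induction
    case one
    show ?case by (intro exI) (auto simp: mat2_arith)
  next
    case (upper P k)
    then obtain p q r s where "P = mat2 p q r s" "p \<ge> 1" "q \<ge> 0" "r \<ge> 0" "s \<ge> 1" by blast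
    then show ?case by (simp add: mat2_arith)
  next
    case (lower P k)
    then obtain p q r s where "P = mat2 p q r s" "p \<ge> 1" "q \<ge> 0" "r \<ge> 0" "s \<ge> 1" by blast
    then show ?case by (simp add: mat2_arith)
  qed
  then show ?thesis using that by blast
qed

text \<open>
  The elements of order 2 and 3 satisfy no further relations. This is a ping-pong argument: modulo
  \<open>x\<^sup>2 = 1\<close> and \<open>y\<^sup>3 = 1\<close> every word can be brought to a reduced form, simultaneously in \<open>PSL(2, \<int>)\<close> and
  in \<open>K\<close>, and the signs of the matrix entries show that a non-empty reduced word is not the identity
  of \<open>PSL(2, \<int>)\<close>.
\<close>

lemma PSL2_int_free_product:
  assumes K: "group K" and xy: "x \<in> carrier K" "y \<in> carrier K"
    and x2: "x \<otimes>\<^bsub>K\<^esub> x = \<one>\<^bsub>K\<^esub>" and y3: "y \<otimes>\<^bsub>K\<^esub> (y \<otimes>\<^bsub>K\<^esub> y) = \<one>\<^bsub>K\<^esub>"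
  obtains h where "h \<in> hom (PSL2 TYPE(int)) K" "h (proj ord2) = x" "h (proj ord3) = y"
proof -
  let ?G = "PSL2 TYPE(int)"
  interpret K: group K by fact
  interpret G: group ?G by (rule group_PSL2)
  interpret GK: group "?G \<times>\<times> K" by (intro DirProd_group group_PSL2 K)
  have x2': "x \<otimes>\<^bsub>K\<^esub> (x \<otimes>\<^bsub>K\<^esub> k) = k" if "k \<in> carrier K" for k
    using that xy x2 by (simp flip: K.m_assoc)
  have y3': "y \<otimes>\<^bsub>K\<^esub> (y \<otimes>\<^bsub>K\<^esub> (y \<otimes>\<^bsub>K\<^esub> k)) = k" if "k \<in> carrier K" for k
    using that xy y3 by (metis K.l_one K.m_assoc K.m_closed)
  let ?a = "(proj ord2, x)" and ?b = "(proj ord3, y)"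
  \<comment> \<open>\<open>\<Gamma>\<close> will be the graph of the homomorphism.\<close>
  define \<Gamma> where "\<Gamma> = generate (?G \<times>\<times> K) {?a, ?b}"
  define B where "B = {(mat 1, \<one>\<^bsub>K\<^esub>), (ord3, y), (ord3 ** ord3, y \<otimes>\<^bsub>K\<^esub> y)}"
  define A where "A = {(mat 1, \<one>\<^bsub>K\<^esub>), (ord2, x)}"
  \<comment> \<open>These are the reduced words of the free product, with their values in \<open>K\<close>: a power of \<open>b\<close>,
    then syllables \<open>a b\<close> and \<open>a b\<^sup>-\<^sup>1\<close>, then possibly a last \<open>a\<close>.\<close>
  define N where "N = {(proj (\<beta> ** P ** \<alpha>), u \<otimes>\<^bsub>K\<^esub> k \<otimes>\<^bsub>K\<^esub> v) | \<alpha> \<beta> P u k v.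
    (\<beta>, u) \<in> B \<and> (P, k) \<in> positive_words K x y \<and> (\<alpha>, v) \<in> A}"
  have words_carrier: "k \<in> carrier K" if "(P, k) \<in> positive_words K x y" for P k
    using that by induction (use xy in auto)
  have words_det: "det P = 1" if "(P, k) \<in> positive_words K x y" for P k
    using that by induction (simp_all add: det_mul mat2_arith(5))
  have NI: "(proj M, k') \<in> N" if "(\<beta>, u) \<in> B" "(P, k) \<in> positive_words K x y" "(\<alpha>, v) \<in> A"
    "M = \<beta> ** P ** \<alpha> \<or> M = - (\<beta> ** P ** \<alpha>)" "k' = u \<otimes>\<^bsub>K\<^esub> k \<otimes>\<^bsub>K\<^esub> v" for \<alpha> \<beta> P u k v M k'
    unfolding N_def using that by (auto intro!: exI simp: proj_eq_iff)
  have ord: "ord2 ** ord2 = - mat 1" "ord3 ** (ord3 ** ord3) = - mat 1"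
    "ord2 ** ord3 = - mat2 1 1 0 1" "ord2 ** (ord3 ** ord3) = - mat2 1 0 1 1"
    by (simp_all add: mat2_arith)
  have N_b: "?b \<otimes>\<^bsub>?G \<times>\<times> K\<^esub> n \<in> N" if "n \<in> N" for n
  proof -
    from that obtain \<alpha> \<beta> P u k v where n: "n = (proj (\<beta> ** P ** \<alpha>), u \<otimes>\<^bsub>K\<^esub> k \<otimes>\<^bsub>K\<^esub> v)"
      and mem: "(\<beta>, u) \<in> B" "(P, k) \<in> positive_words K x y" "(\<alpha>, v) \<in> A"
      unfolding N_def by blast
    have v: "v \<in> carrier K" using mem(3) xy by (auto simp: A_def)
    note [simp] = words_carrier[OF mem(2)] v xy
    from mem(1) consider "\<beta> = mat 1" "u = \<one>\<^bsub>K\<^esub>" | "\<beta> = ord3" "u = y"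
      | "\<beta> = ord3 ** ord3" "u = y \<otimes>\<^bsub>K\<^esub> y" by (auto simp: B_def)
    then show ?thesis
    proof cases
      case 1
      then show ?thesis unfolding n
        by (simp, intro NI[OF _ mem(2,3), of ord3 y]) (auto simp: B_def matrix_mul_assoc K.m_assoc)
    next
      case 2
      then show ?thesis unfolding n
        by (simp, intro NI[OF _ mem(2,3), of "ord3 ** ord3" "y \<otimes>\<^bsub>K\<^esub> y"])
          (auto simp: B_def matrix_mul_assoc K.m_assoc)
    next
      case 3
      have "ord3 ** (ord3 ** ord3 ** P ** \<alpha>) = ord3 ** (ord3 ** ord3) ** P ** \<alpha>"
        by (simp only: matrix_mul_assoc)
      with 3 show ?thesis unfolding n
        by (simp, intro NI[OF _ mem(2,3), of "mat 1" "\<one>\<^bsub>K\<^esub>"])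
          (auto simp: B_def ord matrix_mult_minus K.m_assoc y3')
    qed
  qed
  have N_a: "?a \<otimes>\<^bsub>?G \<times>\<times> K\<^esub> n \<in> N" if "n \<in> N" for n
  proof -
    from that obtain \<alpha> \<beta> P u k v where n: "n = (proj (\<beta> ** P ** \<alpha>), u \<otimes>\<^bsub>K\<^esub> k \<otimes>\<^bsub>K\<^esub> v)"
      and mem: "(\<beta>, u) \<in> B" "(P, k) \<in> positive_words K x y" "(\<alpha>, v) \<in> A"
      unfolding N_def by blast
    have v: "v \<in> carrier K" using mem(3) xy by (auto simp: A_def)
    note [simp] = words_carrier[OF mem(2)] v xy
    from mem(1) consider "\<beta> = mat 1" "u = \<one>\<^bsub>K\<^esub>" | "\<beta> = ord3" "u = y"
      | "\<beta> = ord3 ** ord3" "u = y \<otimes>\<^bsub>K\<^esub> y" by (auto simp: B_def)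
    then show ?thesis
    proof cases
      case 1
      show ?thesis
        using mem(2)
      proof cases
        case one
        have "(ord2 ** \<alpha>, x \<otimes>\<^bsub>K\<^esub> v) \<in> A \<or> ord2 ** \<alpha> = - mat 1 \<and> x \<otimes>\<^bsub>K\<^esub> v = \<one>\<^bsub>K\<^esub>"
          using mem(3) by (auto simp: A_def ord x2)
        then show ?thesis
        proof
          assume "(ord2 ** \<alpha>, x \<otimes>\<^bsub>K\<^esub> v) \<in> A"
          then show ?thesis unfolding n using 1 one
            by (simp, intro NI[of "mat 1" "\<one>\<^bsub>K\<^esub>" "mat 1" "\<one>\<^bsub>K\<^esub>"])
              (auto simp: B_def positive_words.one)
        next
          assume "ord2 ** \<alpha> = - mat 1 \<and> x \<otimes>\<^bsub>K\<^esub> v = \<one>\<^bsub>K\<^esub>"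
          then show ?thesis unfolding n using 1 one
            by (simp, intro NI[of "mat 1" "\<one>\<^bsub>K\<^esub>" "mat 1" "\<one>\<^bsub>K\<^esub>" "mat 1" "\<one>\<^bsub>K\<^esub>"])
              (auto simp: A_def B_def positive_words.one)
        qed
      next
        case (upper P' k')
        note [simp] = words_carrier[OF upper(3)]
        have "ord2 ** (mat2 1 1 0 1 ** P' ** \<alpha>) = ord3 ** P' ** \<alpha>"
          by (simp add: matrix_mul_assoc) (simp add: mat2_arith)
        then show ?thesis unfolding n using 1 upper(1,2)
          by (simp, intro NI[OF _ upper(3) mem(3), of ord3 y])
            (auto simp: B_def K.m_assoc x2')
      next
        case (lower P' k')
        note [simp] = words_carrier[OF lower(3)]
        have "ord2 ** (mat2 1 0 1 1 ** P' ** \<alpha>) = ord3 ** ord3 ** P' ** \<alpha>"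
          by (simp add: matrix_mul_assoc) (simp add: mat2_arith)
        then show ?thesis unfolding n using 1 lower(1,2)
          by (simp, intro NI[OF _ lower(3) mem(3), of "ord3 ** ord3" "y \<otimes>\<^bsub>K\<^esub> y"])
            (auto simp: B_def K.m_assoc x2')
      qed
    next
      case 2
      have "ord2 ** (ord3 ** P ** \<alpha>) = (ord2 ** ord3) ** P ** \<alpha>"
        by (simp only: matrix_mul_assoc)
      with 2 show ?thesis unfolding n
        by (simp, intro NI[OF _ positive_words.upper[OF mem(2)] mem(3), of "mat 1" "\<one>\<^bsub>K\<^esub>"])
          (auto simp: B_def ord matrix_mult_minus K.m_assoc)
    next
      case 3
      have "ord2 ** (ord3 ** ord3 ** P ** \<alpha>) = (ord2 ** (ord3 ** ord3)) ** P ** \<alpha>"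
        by (simp only: matrix_mul_assoc)
      with 3 show ?thesis unfolding n
        by (simp, intro NI[OF _ positive_words.lower[OF mem(2)] mem(3), of "mat 1" "\<one>\<^bsub>K\<^esub>"])
          (auto simp: B_def ord matrix_mult_minus K.m_assoc)
    qed
  qed
  have ab: "?a \<in> carrier (?G \<times>\<times> K)" "?b \<in> carrier (?G \<times>\<times> K)"
    using xy by (auto simp: mat2_arith)
  have N_carrier: "N \<subseteq> carrier (?G \<times>\<times> K)"
    by (rule subsetI) (use xy words_carrier words_det in
      \<open>auto simp: N_def A_def B_def det_mul mat2_arith(5) simp flip: det_I\<close>)
  have one_N: "\<one>\<^bsub>?G \<times>\<times> K\<^esub> \<in> N"
    by (simp add: one_PSL2)
      (rule NI[of "mat 1" "\<one>\<^bsub>K\<^esub>" "mat 1" "\<one>\<^bsub>K\<^esub>" "mat 1" "\<one>\<^bsub>K\<^esub>"], 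
        auto simp: A_def B_def positive_words.one)
  have "\<forall>n\<in>N. g \<otimes>\<^bsub>?G \<times>\<times> K\<^esub> n \<in> N" if "g \<in> \<Gamma>" for g
    using that unfolding \<Gamma>_def
  proof induction
    case one
    then show ?case using N_carrier by auto
  next
    case (incl h)
    then show ?case using N_a N_b by auto
  next
    case (inv h)
    have inv_a: "inv\<^bsub>?G \<times>\<times> K\<^esub> ?a = ?a"
      using x2 xy by (intro GK.inv_equality) (auto simp: one_PSL2 mat2_arith proj_eq_iff)
    have inv_b: "inv\<^bsub>?G \<times>\<times> K\<^esub> ?b = ?b \<otimes>\<^bsub>?G \<times>\<times> K\<^esub> ?b"
      using y3 xy by (intro GK.inv_equality) (auto simp: one_PSL2 mat2_arith proj_eq_iff K.m_assoc)
    have "inv\<^bsub>?G \<times>\<times> K\<^esub> ?b \<otimes>\<^bsub>?G \<times>\<times> K\<^esub> n \<in> N" if "n \<in> N" for n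
    proof -
      have "inv\<^bsub>?G \<times>\<times> K\<^esub> ?b \<otimes>\<^bsub>?G \<times>\<times> K\<^esub> n = ?b \<otimes>\<^bsub>?G \<times>\<times> K\<^esub> (?b \<otimes>\<^bsub>?G \<times>\<times> K\<^esub> n)"
        unfolding inv_b using ab N_carrier that by (intro GK.m_assoc) auto
      then show ?thesis using N_b that by simp
    qed
    with inv inv_a N_a show ?case by auto
  next
    case (eng g h)
    have "g \<in> carrier (?G \<times>\<times> K)" "h \<in> carrier (?G \<times>\<times> K)"
      using GK.generate_in_carrier[of "{?a, ?b}"] eng ab by blast+
    then have "g \<otimes>\<^bsub>?G \<times>\<times> K\<^esub> h \<otimes>\<^bsub>?G \<times>\<times> K\<^esub> n = g \<otimes>\<^bsub>?G \<times>\<times> K\<^esub> (h \<otimes>\<^bsub>?G \<times>\<times> K\<^esub> n)"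
      if "n \<in> N" for n
      using N_carrier that by (intro GK.m_assoc) auto
    then show ?case using eng.IH by simp
  qed
  note \<Gamma>_closed = this
  have \<Gamma>_N: "g \<in> N" if "g \<in> \<Gamma>" for g
  proof -
    have "g \<in> carrier (?G \<times>\<times> K)"
      using that ab unfolding \<Gamma>_def by (intro GK.generate_in_carrier[of "{?a, ?b}"]) auto
    then show ?thesis
      using \<Gamma>_closed[OF that] one_N by (metis GK.r_one)
  qed
  \<comment> \<open>The graph is single-valued because a reduced word that represents the identity is empty.
    If the outer letters \<open>\<beta>\<close> and \<open>\<alpha>\<close> are not both trivial, then \<open>\<beta> P \<alpha>\<close> has a non-zero
    off-diagonal entry, because the entries of \<open>P\<close> are non-negative with positive diagonal.\<close>
  have unique: "k' = \<one>\<^bsub>K\<^esub>" if "(\<one>\<^bsub>?G\<^esub>, k') \<in> \<Gamma>" for k'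
  proof -
    from that have "(\<one>\<^bsub>?G\<^esub>, k') \<in> N" by (rule \<Gamma>_N)
    then obtain \<alpha> \<beta> P u k v where eq: "proj (mat 1) = proj (\<beta> ** P ** \<alpha>)" "k' = u \<otimes>\<^bsub>K\<^esub> k \<otimes>\<^bsub>K\<^esub> v"
      and mem: "(\<beta>, u) \<in> B" "(P, k) \<in> positive_words K x y" "(\<alpha>, v) \<in> A"
      unfolding N_def one_PSL2 by blast
    from mem(2) obtain p q r s where P: "P = mat2 p q r s" "p \<ge> 1" "q \<ge> 0" "r \<ge> 0" "s \<ge> 1"
      "k = \<one>\<^bsub>K\<^esub> \<or> q + r \<ge> 1" by (rule positive_words_shape)
    show ?thesis
      using mem(1,3) eq P
      by (auto simp: A_def B_def proj_eq_iff mat2_arith)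
  qed
  interpret \<Gamma>: subgroup \<Gamma> "?G \<times>\<times> K"
    unfolding \<Gamma>_def using ab by (intro GK.generate_is_subgroup) auto
  interpret fst: group_hom "?G \<times>\<times> K" ?G fst
    by unfold_locales (auto simp: hom_def)
  have "fst ` \<Gamma> = carrier ?G"
  proof (rule PSL2_int_subgroup_eq)
    show "subgroup (fst ` \<Gamma>) ?G" by (rule fst.subgroup_img_is_subgroup) unfold_locales
  qed (force simp: \<Gamma>_def intro: generate.incl)+
  then have ex: "\<exists>k. (g, k) \<in> \<Gamma>" if "g \<in> carrier ?G" for g using that by force
  have carrierD: "g \<in> carrier ?G" "k \<in> carrier K" if "(g, k) \<in> \<Gamma>" for g k
    using that \<Gamma>.subset by auto
  have functional: "k = k'" if "(g, k) \<in> \<Gamma>" "(g, k') \<in> \<Gamma>" for g k k'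
  proof -
    have "(g, k) \<otimes>\<^bsub>?G \<times>\<times> K\<^esub> inv\<^bsub>?G \<times>\<times> K\<^esub> (g, k') \<in> \<Gamma>" using that by blast
    then have "k \<otimes>\<^bsub>K\<^esub> inv\<^bsub>K\<^esub> k' = \<one>\<^bsub>K\<^esub>"
      using carrierD[OF that(1)] carrierD[OF that(2)] by (intro unique) (simp add: group_PSL2 K)
    then show ?thesis
      using carrierD[OF that(1)] carrierD[OF that(2)] K.inv_equality K.inv_inv by fastforce
  qed
  define h where "h g = (THE k. (g, k) \<in> \<Gamma>)" for g
  have h: "h g = k" if "(g, k) \<in> \<Gamma>" for g k
    unfolding h_def using that functional by blast
  have "h \<in> hom ?G K"
  proof (rule homI)
    fix g assume "g \<in> carrier ?G"
    then show "h g \<in> carrier K" using ex h carrierD by blast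
  next
    fix g g' assume "g \<in> carrier ?G" "g' \<in> carrier ?G"
    then obtain k k' where "(g, k) \<in> \<Gamma>" "(g', k') \<in> \<Gamma>" using ex by blast
    moreover from \<Gamma>.m_closed[OF this] have "(g \<otimes>\<^bsub>?G\<^esub> g', k \<otimes>\<^bsub>K\<^esub> k') \<in> \<Gamma>" by simp
    ultimately show "h (g \<otimes>\<^bsub>?G\<^esub> g') = h g \<otimes>\<^bsub>K\<^esub> h g'" using h by simp
  qed
  moreover have "h (proj ord2) = x" "h (proj ord3) = y"
    by (auto intro!: h generate.incl simp: \<Gamma>_def)
  ultimately show thesis using that by blast
qed

section \<open>The modular group modulo its second derived subgroup\<close>

text \<open>
  The pair \<open>(u, v)\<close> stands for the map \<open>z \<mapsto> u z + v\<close> of the complex plane.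
\<close>

definition affine_group :: "(complex \<times> complex) monoid"
  where "affine_group = \<lparr>carrier = {(u, v). u \<noteq> 0}, monoid.mult = (\<lambda>(u, v) (u', v'). (u * u', v + u * v')),
    one = (1, 0)\<rparr>"

lemma group_affine_group: "group affine_group"
proof (rule groupI)
  fix x assume "x \<in> carrier affine_group"
  then show "\<exists>y\<in>carrier affine_group. y \<otimes>\<^bsub>affine_group\<^esub> x = \<one>\<^bsub>affine_group\<^esub>"
    by (intro bexI[of _ "(1 / fst x, - snd x / fst x)"]) (auto simp: affine_group_def)
qed (auto simp: affine_group_def algebra_simps)

lemma affine_group_simps [simp]:
  "(u, v) \<in> carrier affine_group \<longleftrightarrow> u \<noteq> 0"
  "(u, v) \<otimes>\<^bsub>affine_group\<^esub> (u', v') = (u * u', v + u * v')"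
  "\<one>\<^bsub>affine_group\<^esub> = (1, 0)"
  by (simp_all add: affine_group_def)

lemma inv_affine_group [simp]:
  "u \<noteq> 0 \<Longrightarrow> inv\<^bsub>affine_group\<^esub> (u, v) = (1 / u, - v / u)"
  by (rule group.inv_equality[OF group_affine_group]) auto

text \<open>
  Commutators are translations, and translations commute.
\<close>

lemma second_derived_affine_group: "second_derived affine_group = {\<one>\<^bsub>affine_group\<^esub>}"
proof -
  interpret group affine_group by (rule group_affine_group)
  let ?T = "{x. fst x = (1::complex)}"
  have T: "subgroup ?T affine_group"
    by (rule subgroupI) (auto simp del: affine_group_simps(3))
  have "derived affine_group (carrier affine_group) \<subseteq> ?T"
    unfolding derived_def by (rule generate_subgroup_incl[OF _ T]) auto
  then have "second_derived affine_group \<subseteq> derived affine_group ?T"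
    unfolding second_derived_def by (rule mono_derived)
  also have "\<dots> \<subseteq> {\<one>\<^bsub>affine_group\<^esub>}"
    unfolding derived_def by (rule generate_subgroup_incl[OF _ triv_subgroup]) auto
  finally show ?thesis
    using subgroup.one_closed[OF derived_is_subgroup[OF derived_in_carrier[OF order_refl]]]
    by (auto simp: second_derived_def)
qed

text \<open>
  Let \<open>a\<close> act on the complex plane as the half-turn \<open>z \<mapsto> 1 - z\<close> and \<open>b\<close> as the rotation by a third of a
  turn about 0. The two centres of rotation differ, so the group that arises contains a non-trivial
  translation.
\<close>

lemma infinite_PSL2_int_quotient:
  "infinite (carrier (PSL2 TYPE(int) Mod second_derived (PSL2 TYPE(int))))"
proof -
  define \<omega> where "\<omega> = Complex (- 1 / 2) (sqrt 3 / 2)"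
  have \<omega>: "\<omega> * \<omega> + \<omega> + 1 = 0" "\<omega> \<noteq> 0" "\<omega> \<noteq> 1"
    by (auto simp: \<omega>_def complex_eq_iff algebra_simps)
  have \<omega>3: "\<omega> * (\<omega> * \<omega>) = 1"
  proof -
    have "\<omega> * (\<omega> * \<omega>) - 1 = (\<omega> - 1) * (\<omega> * \<omega> + \<omega> + 1)" by (simp add: algebra_simps)
    then show ?thesis using \<omega>(1) by simp
  qed
  obtain h where h: "h \<in> hom (PSL2 TYPE(int)) affine_group" "h (proj ord2) = (- 1, 1)" "h (proj ord3) = (\<omega>, 0)"
    by (rule PSL2_int_free_product[OF group_affine_group, of "(- 1, 1)" "(\<omega>, 0)"]) (use \<omega> \<omega>3 in auto)
  interpret group_hom "PSL2 TYPE(int)" affine_group h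
    by (intro group_hom.intro group_hom_axioms.intro group_PSL2 group_affine_group h)
  have ord: "proj ord2 \<in> carrier (PSL2 TYPE(int))" "proj ord3 \<in> carrier (PSL2 TYPE(int))"
    by (simp_all add: mat2_arith)
  \<comment> \<open>The commutator of the two generators; it acts as the translation by \<open>1 - \<omega>\<close>.\<close>
  define g where "g = proj ord2 \<otimes>\<^bsub>PSL2 TYPE(int)\<^esub> proj ord3
    \<otimes>\<^bsub>PSL2 TYPE(int)\<^esub> proj ord2 \<otimes>\<^bsub>PSL2 TYPE(int)\<^esub> (proj ord3 \<otimes>\<^bsub>PSL2 TYPE(int)\<^esub> proj ord3)"
  have g: "g \<in> carrier (PSL2 TYPE(int))" unfolding g_def using ord by blast
  have "h g = (1, 1 - \<omega>)"
    unfolding g_def using ord \<omega>3 by (simp add: h(2,3) del: proj_mult)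
  then have "h (g [^]\<^bsub>PSL2 TYPE(int)\<^esub> n) = (1, of_nat n * (1 - \<omega>))" for n :: nat
    by (induction n) (simp_all add: g algebra_simps)
  then have "range (\<lambda>n. (1, of_nat n * (1 - \<omega>))) \<subseteq> h ` carrier (PSL2 TYPE(int))"
    using g by (metis (no_types, lifting) G.nat_pow_closed image_subset_iff imageI rangeE subsetI)
  moreover have "infinite (range (\<lambda>n. (1 :: complex, of_nat n * (1 - \<omega>))))"
    using \<omega>(3) by (intro range_inj_infinite) (auto simp: inj_def)
  ultimately have "infinite (h ` carrier (PSL2 TYPE(int)))"
    by (rule infinite_super)
  then show ?thesis
    by (intro infinite_quotient_second_derived[OF _ second_derived_affine_group]) unfold_locales
qed

section \<open>Commutators of generating pairs of the modular group\<close>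

text \<open>
  Moving \<open>C = A B - B A\<close> past \<open>A\<close> or \<open>B\<close> turns these into their adjugates. So the left ideal of \<open>C\<close> is
  stable under right multiplication by the generators, hence by all of \<open>SL(2, R)\<close>, and modulo this
  ideal the generators commute, hence so do all elements of \<open>SL(2, R)\<close>.
\<close>

lemma commutator_ideal:
  fixes A B X Y :: "'a::comm_ring_1 ^ 2 ^ 2"
  assumes gen: "generate (PSL2 TYPE('a)) {proj A, proj B} = carrier (PSL2 TYPE('a))"
    and det: "det A = 1" "det B = 1" "det X = 1" "det Y = 1"
  shows "\<exists>Z. X ** Y - Y ** X = Z ** (A ** B - B ** A)"
proof -
  define C where "C = A ** B - B ** A"
  define J where "J = range (\<lambda>Z :: 'a ^ 2 ^ 2. Z ** C)"
  have distribs: "(X + Y) ** Z = X ** Z + Y ** Z" "(X - Y) ** Z = X ** Z - Y ** Z"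
    "Z ** (X + Y) = Z ** X + Z ** Y" "Z ** (X - Y) = Z ** X - Z ** Y" for X Y Z :: "'a ^ 2 ^ 2"
    by (rule mat2_exhaust[of X], rule mat2_exhaust[of Y], rule mat2_exhaust[of Z],
        simp add: mat2_arith algebra_simps)+
  have J_add: "X + Y \<in> J" if "X \<in> J" "Y \<in> J" for X Y
  proof -
    from that obtain Z Z' where "X = Z ** C" "Y = Z' ** C" by (auto simp: J_def)
    then have "X + Y = (Z + Z') ** C" by (simp add: distribs)
    then show ?thesis by (simp add: J_def)
  qed
  have J_minus: "- X \<in> J" if "X \<in> J" for X
    using that unfolding J_def by (auto simp flip: matrix_mult_minus)
  have J_left: "X ** Y \<in> J" if "Y \<in> J" for X Y
    using that unfolding J_def by (auto simp: matrix_mul_assoc)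
  \<comment> \<open>\<open>C A + A C = trace A * C\<close>, because \<open>C A + A C\<close> is the difference \<open>A\<^sup>2 B - B A\<^sup>2\<close> and
    \<open>A\<^sup>2 = trace A * A - det A\<close>; likewise for \<open>B\<close>.\<close>
  have swap: "C ** A = adj2 A ** C" "C ** B = adj2 B ** C" "C ** adj2 A = A ** C" "C ** adj2 B = B ** C"
    unfolding C_def by (rule mat2_exhaust[of A], rule mat2_exhaust[of B], simp add: mat2_arith algebra_simps)+
  have "C ** X \<in> J" if "det X = 1" for X
    using gen det(1,2) that
  proof (induction rule: PSL2_generate_induct)
    case one
    then show ?case unfolding J_def by (metis matrix_mul_lid matrix_mul_rid rangeI)
  next
    case (minus X)
    then show ?case using J_minus by (simp add: matrix_mult_minus)
  next
    case (mult X Y)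
    then obtain Z where "C ** X = Z ** C" unfolding J_def by auto
    then have "C ** (X ** Y) = Z ** (C ** Y)" by (simp add: matrix_mul_assoc)
    with mult show ?case using J_left by simp
  qed (auto simp: swap J_def)
  then have J_right: "Y ** X \<in> J" if "Y \<in> J" "det X = 1" for X Y
    using that J_left unfolding J_def by (auto simp flip: matrix_mul_assoc)
  \<comment> \<open>By the product rule \<open>[X Y, U] = X [Y, U] + [X, U] Y\<close>, it suffices to test generators.\<close>
  have commutes: "X ** U - U ** X \<in> J"
    if U: "A ** U - U ** A \<in> J" "B ** U - U ** B \<in> J" and "det X = 1" for U X
    using gen det(1,2) \<open>det X = 1\<close>
  proof (induction rule: PSL2_generate_induct)
    case one
    have "mat 1 ** U - U ** mat 1 = 0 ** C"
      by (rule mat2_exhaust[of U], rule mat2_exhaust[of C]) (simp add: mat2_arith)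
    then show ?case unfolding J_def by blast
  next
    case inv_fst
    have "adj2 A ** U - U ** adj2 A = - (A ** U - U ** A)"
      by (rule mat2_exhaust[of A], rule mat2_exhaust[of U]) (simp add: mat2_arith algebra_simps)
    then show ?case using J_minus[OF U(1)] by simp
  next
    case inv_snd
    have "adj2 B ** U - U ** adj2 B = - (B ** U - U ** B)"
      by (rule mat2_exhaust[of B], rule mat2_exhaust[of U]) (simp add: mat2_arith algebra_simps)
    then show ?case using J_minus[OF U(2)] by simp
  next
    case (minus X)
    have "- X ** U - U ** (- X) = - (X ** U - U ** X)" by (simp add: matrix_mult_minus)
    then show ?case using J_minus[OF minus] by simp
  next
    case (mult X Y)
    have "X ** Y ** U - U ** (X ** Y) = X ** (Y ** U - U ** Y) + (X ** U - U ** X) ** Y"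
      by (simp add: distribs matrix_mul_assoc)
    with mult show ?case using J_add J_left J_right by simp
  qed (use U in auto)
  have swap_J: "U ** V - V ** U \<in> J" if "V ** U - U ** V \<in> J" for U V
    using J_minus[OF that] by simp
  have C: "C \<in> J" unfolding J_def by (metis matrix_mul_lid rangeI)
  have zero: "U ** U - U ** U \<in> J" for U
    using J_add[OF C J_minus[OF C]] by simp
  have AB: "A ** B - B ** A \<in> J" using C by (simp add: C_def)
  have "X ** Y - Y ** X \<in> J"
    by (intro commutes[OF _ _ det(3)] swap_J[OF commutes[OF _ _ det(4)]] zero AB swap_J[OF AB])
  then show ?thesis unfolding J_def C_def by blast
qed

text \<open>
  Modulo 3 the left-hand side vanishes only if \<open>x\<close>, \<open>y\<close> and \<open>z\<close> do, and then it is divisible by 9.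
\<close>

lemma markov_type_mod_3: "x\<^sup>2 + y\<^sup>2 + z\<^sup>2 - x * y * z \<noteq> (3::int)"
proof
  assume eq: "x\<^sup>2 + y\<^sup>2 + z\<^sup>2 - x * y * z = 3"
  have "((x mod 3)\<^sup>2 + (y mod 3)\<^sup>2 + (z mod 3)\<^sup>2 - (x mod 3) * (y mod 3) * (z mod 3)) mod 3
      = (x\<^sup>2 + y\<^sup>2 + z\<^sup>2 - x * y * z) mod 3"
    unfolding power2_eq_square
    by (intro mod_diff_cong mod_add_cong mod_mult_cong) simp_all
  also have "\<dots> = 0" using eq by simp
  finally have *: "((x mod 3)\<^sup>2 + (y mod 3)\<^sup>2 + (z mod 3)\<^sup>2 - (x mod 3) * (y mod 3) * (z mod 3)) mod 3 = 0" .
  have residue: "t mod 3 = 0 \<or> t mod 3 = 1 \<or> t mod 3 = 2" for t :: int by presburger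
  have "x mod 3 = 0 \<and> y mod 3 = 0 \<and> z mod 3 = 0"
    using residue[of x] residue[of y] residue[of z] *
    by (elim disjE) (simp_all add: power2_eq_square)
  then obtain x' y' z' where "x = 3 * x'" "y = 3 * y'" "z = 3 * z'" by (auto elim!: dvdE)
  with eq have "3 * (x'\<^sup>2 + y'\<^sup>2 + z'\<^sup>2 - 3 * (x' * y' * z')) = 1"
    by (simp add: power2_eq_square)
  then show False by presburger
qed

lemma generating_pair_trace_commutator:
  fixes A B :: "int ^ 2 ^ 2"
  assumes gen: "generate (PSL2 TYPE(int)) {proj A, proj B} = carrier (PSL2 TYPE(int))"
    and det: "det A = 1" "det B = 1"
  shows "trace (commutator A B) = 3"
proof -
  let ?T = "mat2 1 1 0 (1::int)" and ?L = "mat2 1 0 1 (1::int)"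
  \<comment> \<open>The difference \<open>T L - L T\<close> is the diagonal matrix with entries 1 and \<open>-1\<close>.\<close>
  obtain Z where "?T ** ?L - ?L ** ?T = Z ** (A ** B - B ** A)"
    using commutator_ideal[OF gen det, of ?T ?L] by (auto simp: mat2_arith)
  then have "det Z * det (A ** B - B ** A) = det (?T ** ?L - ?L ** ?T)"
    by (simp add: det_mul)
  also have "\<dots> = - 1" by (simp add: mat2_arith)
  finally have "det (A ** B - B ** A) dvd 1" by (metis dvd_minus_iff dvd_triv_right)
  then have "det (A ** B - B ** A) = 1 \<or> det (A ** B - B ** A) = - 1"
    by (simp add: zdvd1_eq abs_eq_iff')
  then have "trace (commutator A B) = 1 \<or> trace (commutator A B) = 3"
    unfolding trace_commutator_det[OF det] by linarith
  moreover have "trace (commutator A B) \<noteq> 1"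
    using markov_type_mod_3[of "trace A" "trace B" "trace (A ** B)"] trace_commutator[OF det] by auto
  ultimately show ?thesis by blast
qed

definition conjugate :: "'a::comm_ring_1 ^ 2 ^ 2 \<Rightarrow> 'a ^ 2 ^ 2 \<Rightarrow> bool"
  where "conjugate A B \<longleftrightarrow> (\<exists>X. det X = 1 \<and> B = X ** A ** adj2 X)"

lemma conjugate_trans:
  assumes "conjugate A B" "conjugate B C"
  shows "conjugate A C"
proof -
  obtain X Y where "det X = 1" "B = X ** A ** adj2 X" "det Y = 1" "C = Y ** B ** adj2 Y"
    using assms by (auto simp: conjugate_def)
  then show ?thesis
    unfolding conjugate_def by (intro exI[of _ "Y ** X"]) (simp add: det_mul adj2_mult matrix_mul_assoc)
qed

lemma conjugateI: "det X = 1 \<Longrightarrow> X ** A ** adj2 X = B \<Longrightarrow> conjugate A B"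
  by (auto simp: conjugate_def)

text \<open>
  The reduction theory of binary quadratic forms of discriminant 5, which form a single class.
  Conjugating by elementary matrices decreases the difference of the diagonal entries until it is at
  most \<open>\<bar>q\<bar>\<close> and \<open>\<bar>r\<bar>\<close>; four matrices remain.
\<close>

lemma trace_3_conjugate:
  fixes p q r s :: int
  assumes "p * s - q * r = 1" "p + s = 3"
  shows "conjugate (mat2 p q r s) (mat2 2 1 1 1)"
  using assms
proof (induction "nat \<bar>p - s\<bar>" arbitrary: p q r s rule: less_induct)
  case less
  \<comment> \<open>The discriminant of the characteristic polynomial.\<close>
  have disc: "(p - s)\<^sup>2 + 4 * (q * r) = 5"
  proof -
    have "(p - s)\<^sup>2 + 4 * (q * r) = (p + s)\<^sup>2 - 4 * (p * s - q * r)"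
      by (simp add: power2_eq_square algebra_simps)
    then show ?thesis using less.prems by simp
  qed
  have odd: "p - s \<noteq> 0" using less.prems by presburger
  have no_sqrt_5: "x\<^sup>2 \<noteq> 5" for x :: int
  proof
    assume "x\<^sup>2 = 5"
    then have "x\<^sup>2 mod 4 = 1" "\<bar>x\<bar> < 3" using power2_less_imp_less[of "\<bar>x\<bar>" 3] by auto
    then have "x \<in> {-2, -1, 0, 1, 2}" by auto
    with \<open>x\<^sup>2 = 5\<close> show False by auto
  qed
  have qr: "q \<noteq> 0" "r \<noteq> 0" using disc no_sqrt_5 by auto
  \<comment> \<open>Conjugation by \<open>(1 e; 0 1)\<close> changes \<open>p - s\<close> by \<open>2 e r\<close>, and conjugation by \<open>(1 0; -e 1)\<close> changes it
    by \<open>2 e q\<close>.\<close>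
  have reduce: "\<exists>e\<in>{1, -1}. \<bar>(p - s) + 2 * (e * c)\<bar> < \<bar>p - s\<bar>" if "\<bar>c\<bar> < \<bar>p - s\<bar>" "c \<noteq> 0" for c
    using that by (auto simp: abs_if)
  consider "\<bar>r\<bar> < \<bar>p - s\<bar>" | "\<bar>q\<bar> < \<bar>p - s\<bar>" | "\<bar>p - s\<bar> \<le> \<bar>q\<bar>" "\<bar>p - s\<bar> \<le> \<bar>r\<bar>" by linarith
  then show ?case
  proof cases
    case 1
    then obtain e where e: "e \<in> {1, - 1}" "\<bar>(p - s) + 2 * (e * r)\<bar> < \<bar>p - s\<bar>"
      using reduce[of r] qr by blast
    let ?X = "mat2 1 e 0 (1::int)"
    have X: "?X ** mat2 p q r s ** adj2 ?X = mat2 (p + e * r) (q + e * s - e * (p + e * r)) r (s - e * r)"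
      by (simp add: mat2_arith algebra_simps)
    have "conjugate (mat2 (p + e * r) (q + e * s - e * (p + e * r)) r (s - e * r)) (mat2 2 1 1 1)"
      using less.prems e by (intro less.hyps) (auto simp: algebra_simps)
    then show ?thesis
      using conjugate_trans[OF conjugateI[OF _ X]] by (simp add: mat2_arith)
  next
    case 2
    then obtain e where e: "e \<in> {1, - 1}" "\<bar>(p - s) + 2 * (e * q)\<bar> < \<bar>p - s\<bar>"
      using reduce[of q] qr by blast
    let ?X = "mat2 1 0 (- e) (1::int)"
    have X: "?X ** mat2 p q r s ** adj2 ?X = mat2 (p + e * q) q (r - e * p + e * (s - e * q)) (s - e * q)"
      by (simp add: mat2_arith algebra_simps)
    have "conjugate (mat2 (p + e * q) q (r - e * p + e * (s - e * q)) (s - e * q)) (mat2 2 1 1 1)"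
      using less.prems e by (intro less.hyps) (auto simp: algebra_simps)
    then show ?thesis
      using conjugate_trans[OF conjugateI[OF _ X]] by (simp add: mat2_arith)
  next
    case 3
    have sq: "(p - s)\<^sup>2 \<le> \<bar>q * r\<bar>"
    proof -
      have "\<bar>p - s\<bar> * \<bar>p - s\<bar> \<le> \<bar>q\<bar> * \<bar>r\<bar>" by (intro mult_mono 3) auto
      then show ?thesis by (simp only: abs_mult abs_mult_self_eq power2_eq_square)
    qed
    have "(p - s)\<^sup>2 \<ge> 1" using odd by (smt (verit) zero_less_power2)
    \<comment> \<open>If \<open>q r\<close> were negative, \<open>(p - s)\<^sup>2 + 4 q r\<close> would be at most \<open>-3 (p - s)\<^sup>2\<close>.\<close>
    with sq disc have "q * r = 1" "(p - s)\<^sup>2 = 1" by linarith+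
    then have "p - s = 1 \<or> p - s = - 1" "q = 1 \<and> r = 1 \<or> q = - 1 \<and> r = - 1"
      by (auto simp: power2_eq_1_iff zmult_eq_1_iff)
    with less.prems(2) consider
      "p = 2" "s = 1" "q = 1" "r = 1" | "p = 2" "s = 1" "q = - 1" "r = - 1"
      | "p = 1" "s = 2" "q = 1" "r = 1" | "p = 1" "s = 2" "q = - 1" "r = - 1" by force
    then show ?thesis
    proof cases
      case 1
      then show ?thesis by (intro conjugateI[of "mat2 1 0 0 1"]) (simp_all add: mat2_arith)
    next
      case 2
      then show ?thesis by (intro conjugateI[of "mat2 1 (- 1) 1 0"]) (simp_all add: mat2_arith)
    next
      case 3
      then show ?thesis by (intro conjugateI[of "mat2 1 1 0 1"]) (simp_all add: mat2_arith)
    next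
      case 4
      then show ?thesis by (intro conjugateI[of "mat2 0 1 (- 1) 0"]) (simp_all add: mat2_arith)
    qed
  qed
qed

section \<open>The group PSL(2, 5)\<close>

lemma five_cases:
  fixes x :: 5
  obtains "x = 0" | "x = 1" | "x = 2" | "x = 3" | "x = 4"
proof (cases x)
  case (of_int z)
  then have "z \<in> {0, 1, 2, 3, 4}" by auto
  then show ?thesis using of_int that by auto
qed

lemma five_no_zero_divisors: "x * y = 0 \<longleftrightarrow> x = 0 \<or> y = (0::5)"
  by (cases x rule: five_cases; cases y rule: five_cases) simp_all

lemma five_inverse: obtains y where "x * y = (1::5)" | "x = 0"
proof (cases x rule: five_cases)
  case 2 then show ?thesis using that(1)[of 1] by simp
next
  case 3 then show ?thesis using that(1)[of 3] by simp
next
  case 4 then show ?thesis using that(1)[of 2] by simp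
next
  case 5 then show ?thesis using that(1)[of 4] by simp
qed (use that in auto)

lemma five_of_nat: obtains k where "x = (of_nat k :: 5)"
proof (cases x rule: five_cases)
  case 1 then show ?thesis using that[of 0] by simp
next
  case 2 then show ?thesis using that[of 1] by simp
next
  case 3 then show ?thesis using that[of 2] by simp
next
  case 4 then show ?thesis using that[of 3] by simp
next
  case 5 then show ?thesis using that[of 4] by simp
qed

text \<open>
  The entry 2 is what makes the pair exceptional: the commutator of these two matrices has trace
  \<open>2 + 2\<^sup>2 = 1\<close>, while with entry 1 it would have trace 3, the value for the images of generating pairs
  of \<open>PSL(2, \<int>)\<close> under reduction modulo 5.
\<close>

abbreviation (input) upper :: "5 ^ 2 ^ 2" where "upper \<equiv> mat2 1 1 0 1"

abbreviation (input) lower :: "5 ^ 2 ^ 2" where "lower \<equiv> mat2 1 0 2 1"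

text \<open>
  The powers of the two elements are all elementary matrices, and these generate \<open>SL(2, F)\<close> over every
  field \<open>F\<close>: three of them suffice if the lower left entry is not 0.
\<close>

lemma PSL2_5_subgroup_eq:
  assumes K: "subgroup K (PSL2 TYPE(5))" and mem: "proj upper \<in> K" "proj lower \<in> K"
  shows "K = carrier (PSL2 TYPE(5))"
proof -
  interpret K: subgroup K "PSL2 TYPE(5)" by fact
  have m: "proj (A ** B) \<in> K" if "proj A \<in> K" "proj B \<in> K" for A B
    using K.m_closed[OF that] by simp
  have "proj (mat2 1 (of_nat k) 0 1) \<in> K \<and> proj (mat2 1 0 (2 * of_nat k) 1) \<in> K" for k
  proof (induction k)
    case 0
    then show ?case using K.one_closed by (simp add: one_PSL2 mat2_arith)
  next
    case (Suc k)
    then show ?case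
      using m[OF mem(1), of "mat2 1 (of_nat k) 0 1"] m[OF mem(2), of "mat2 1 0 (2 * of_nat k) 1"]
      by (simp add: mat2_arith algebra_simps)
  qed
  then have U: "proj (mat2 1 x 0 1) \<in> K" and L2: "proj (mat2 1 0 (2 * x) 1) \<in> K" for x
    using five_of_nat[of x] by metis+
  have L: "proj (mat2 1 0 x 1) \<in> K" for x
  proof -
    have "2 * (3 * x) = x" by (cases x rule: five_cases) simp_all
    then show ?thesis using L2[of "3 * x"] by (simp only:)
  qed
  have nonzero: "proj (mat2 a b c d) \<in> K" if det: "a * d - b * c = 1" and c: "c \<noteq> 0" for a b c d
  proof -
    obtain y where y: "c * y = 1" using five_inverse[of c] c by blast
    have "mat2 1 ((a - 1) * y) 0 1 ** mat2 1 0 c 1 ** mat2 1 ((d - 1) * y) 0 1 = mat2 a b c d"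
    proof -
      have 1: "1 + (a - 1) * y * c = a" "c * ((d - 1) * y) + 1 = d"
      proof -
        have "1 + (a - 1) * y * c = 1 + (a - 1) * (c * y)" "c * ((d - 1) * y) + 1 = (c * y) * (d - 1) + 1"
          by (simp_all add: ac_simps)
        then show "1 + (a - 1) * y * c = a" "c * ((d - 1) * y) + 1 = d" using y by simp_all
      qed
      have "a * ((d - 1) * y) + (a - 1) * y = (a * d - 1) * y" by (simp add: algebra_simps)
      also have "\<dots> = b * (c * y)" using det by (simp add: algebra_simps)
      finally have 2: "a * ((d - 1) * y) + (a - 1) * y = b" using y by simp
      show ?thesis using 1 2 by (simp add: mat2_arith)
    qed
    then show ?thesis using m[OF m[OF U L] U] by metis
  qed
  have "proj (mat2 a b c d) \<in> K" if det: "a * d - b * c = 1" for a b c d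
  proof (cases "c = 0")
    case True
    with det have "d \<noteq> 0" by auto
    with det True have "proj (mat2 (a + b) b d d) \<in> K" by (intro nonzero) (auto simp: algebra_simps)
    \<comment> \<open>Adding the second column to the first makes the lower left entry \<open>d\<close>, which is not 0.\<close>
    from m[OF this L[of "- 1"]] show ?thesis using True by (simp add: mat2_arith)
  qed (use nonzero det in blast)
  then have "carrier (PSL2 TYPE(5)) \<subseteq> K"
    unfolding carrier_PSL2 by (metis (mono_tags, lifting) image_subsetI mat2_arith(5) mat2_exhaust mem_Collect_eq)
  with K.subset show ?thesis by blast
qed

text \<open>
  Conjugation by the diagonal matrix with entries 2 and \<open>3 = 2\<^sup>-\<^sup>1\<close> multiplies the off-diagonal entry of
  an elementary matrix by 4 or \<open>4\<^sup>-\<^sup>1 = 4\<close>, so the commutator with that matrix multiplies it by 3.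
\<close>

lemma PSL2_5_perfect: "derived (PSL2 TYPE(5)) (carrier (PSL2 TYPE(5))) = carrier (PSL2 TYPE(5))"
proof (rule PSL2_5_subgroup_eq)
  have mem: "proj (commutator A B) \<in> derived (PSL2 TYPE(5)) (carrier (PSL2 TYPE(5)))"
    if "det A = 1" "det B = 1" for A B
    unfolding derived_def
    by (intro generate.incl UN_I[of "proj A"] UN_I[of "proj B"])
       (use that in \<open>simp_all add: commutator_def\<close>)
  show "proj upper \<in> derived (PSL2 TYPE(5)) (carrier (PSL2 TYPE(5)))"
  proof -
    have "commutator (mat2 2 0 0 3) (mat2 1 2 0 1) = upper" by (simp add: commutator_def mat2_arith)
    then show ?thesis using mem[of "mat2 2 0 0 3" "mat2 1 2 0 1"] by (simp add: mat2_arith(5))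
  qed
  show "proj lower \<in> derived (PSL2 TYPE(5)) (carrier (PSL2 TYPE(5)))"
  proof -
    have "commutator (mat2 2 0 0 3) (mat2 1 0 4 1) = lower" by (simp add: commutator_def mat2_arith)
    then show ?thesis using mem[of "mat2 2 0 0 3" "mat2 1 0 4 1"] by (simp add: mat2_arith(5))
  qed
qed (rule group.derived_is_subgroup[OF group_PSL2 order_refl])

lemma PSL2_5_generate: "generate (PSL2 TYPE(5)) {proj upper, proj lower} = carrier (PSL2 TYPE(5))"
proof (rule PSL2_5_subgroup_eq)
  show "subgroup (generate (PSL2 TYPE(5)) {proj upper, proj lower}) (PSL2 TYPE(5))"
    by (rule group.generate_is_subgroup[OF group_PSL2]) (auto simp: mat2_arith)
qed (auto intro: generate.incl)

definition scalar :: "5 ^ 2 ^ 2 \<Rightarrow> bool"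
  where "scalar M \<longleftrightarrow> (\<exists>u. M = mat2 u 0 0 u)"

lemma scalar_commutes:
  assumes "scalar M"
  shows "M ** N = N ** M"
proof -
  from assms obtain u where "M = mat2 u 0 0 u" by (auto simp: scalar_def)
  then show ?thesis by (rule_tac mat2_exhaust[of N]) (simp add: mat2_arith algebra_simps)
qed

lemma pm_one_entries:
  fixes M :: "'a::comm_ring_1 ^ 2 ^ 2"
  assumes "M = mat 1 \<or> M = - mat 1"
  shows "M $ 1 $ 2 = 0" "M $ 2 $ 1 = 0" "M $ 1 $ 1 - M $ 2 $ 2 = 0"
  using assms by (auto simp: mat_def)

text \<open>
  By the Cayley-Hamilton theorem, \<open>M\<^sup>2\<close> is \<open>trace M * M\<close> up to a scalar matrix.
\<close>

lemma square_scalar_imp: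
  assumes "M ** M = mat 1 \<or> M ** M = - mat 1"
  shows "trace M = 0 \<or> scalar M"
proof -
  obtain a b c d where M: "M = mat2 a b c d" by (rule mat2_exhaust)
  have "b * (a + d) = (M ** M) $ 1 $ 2" "c * (a + d) = (M ** M) $ 2 $ 1"
    "(a - d) * (a + d) = (M ** M) $ 1 $ 1 - (M ** M) $ 2 $ 2"
    by (simp_all add: M mat2_arith algebra_simps)
  then have "b * (a + d) = 0" "c * (a + d) = 0" "(a - d) * (a + d) = 0"
    using pm_one_entries[OF assms] by simp_all
  then show ?thesis
    unfolding five_no_zero_divisors by (auto simp: M mat2_arith scalar_def)
qed

text \<open>
  By the Cayley-Hamilton theorem, \<open>M\<^sup>3\<close> is \<open>((trace M)\<^sup>2 - 1) * M\<close> up to a scalar matrix.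
\<close>

lemma cube_scalar_imp:
  assumes "M ** M ** M = mat 1 \<or> M ** M ** M = - mat 1" "det M = 1"
  shows "(trace M)\<^sup>2 = 1 \<or> scalar M"
proof -
  obtain a b c d where M: "M = mat2 a b c d" by (rule mat2_exhaust)
  let ?k = "(a + d)\<^sup>2 - (a * d - b * c)"
  have "b * ?k = (M ** M ** M) $ 1 $ 2" "c * ?k = (M ** M ** M) $ 2 $ 1"
    "(a - d) * ?k = (M ** M ** M) $ 1 $ 1 - (M ** M ** M) $ 2 $ 2"
    by (simp_all add: M mat2_arith power2_eq_square algebra_simps)
  then have "b * ?k = 0" "c * ?k = 0" "(a - d) * ?k = 0"
    using pm_one_entries[OF assms(1)] by simp_all
  then show ?thesis
    using assms(2) unfolding five_no_zero_divisors by (auto simp: M mat2_arith scalar_def)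
qed

text \<open>
  For \<open>X\<close> and \<open>M\<close> of determinant 1, conjugation by \<open>X\<close> maps \<open>M\<close> to \<open>M\<close> or to \<open>M\<^sup>-\<^sup>1\<close>. Recording the effect on
  the adjugate of \<open>M\<close> as well makes closure under products immediate.
\<close>

definition fixes_or_inverts :: "'a::comm_ring_1 ^ 2 ^ 2 \<Rightarrow> 'a ^ 2 ^ 2 \<Rightarrow> bool"
  where "fixes_or_inverts M X \<longleftrightarrow> X ** M = M ** X \<and> X ** adj2 M = adj2 M ** X
    \<or> X ** M = adj2 M ** X \<and> X ** adj2 M = M ** X"

lemma fixes_or_inverts_mult:
  assumes "fixes_or_inverts M X" "fixes_or_inverts M Y"
  shows "fixes_or_inverts M (X ** Y)"
proof -
  have "X ** Y ** N = N'' ** (X ** Y)" if "Y ** N = N' ** Y" "X ** N' = N'' ** X" for N N' N''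
  proof -
    have "X ** Y ** N = X ** N' ** Y" using that(1) by (simp flip: matrix_mul_assoc)
    then show ?thesis using that(2) by (simp add: matrix_mul_assoc)
  qed
  then show ?thesis using assms unfolding fixes_or_inverts_def by blast
qed

lemma fixes_or_inverts_minus: "fixes_or_inverts M (- X) \<longleftrightarrow> fixes_or_inverts M X"
  by (simp add: fixes_or_inverts_def matrix_mult_minus)

lemma adj2_commutes: "M ** adj2 M = adj2 M ** M"
  by (rule mat2_exhaust[of M]) (simp add: mat2_arith algebra_simps)

lemma fixes_or_inverts_self: "fixes_or_inverts M M" "fixes_or_inverts M (adj2 M)" "fixes_or_inverts M (mat 1)"
  by (simp_all add: fixes_or_inverts_def adj2_commutes)

text \<open>
  For determinant 1, trace 0 means that the inverse is the negative, so
  \<open>A B = - (A B)\<^sup>-\<^sup>1 = - B\<^sup>-\<^sup>1 A\<^sup>-\<^sup>1 = B\<^sup>-\<^sup>1 A\<close>.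
\<close>

lemma fixes_or_inverts_if_trace_0:
  fixes A B :: "'a::comm_ring_1 ^ 2 ^ 2"
  assumes "trace A = 0" "trace (A ** B) = 0"
  shows "fixes_or_inverts B A" "fixes_or_inverts B (adj2 A)"
proof -
  obtain a b c d where A: "A = mat2 a b c d" by (rule mat2_exhaust)
  obtain e f g h where B: "B = mat2 e f g h" by (rule mat2_exhaust)
  have d: "d = - a" and 1: "a * e + b * g + (c * f + d * h) = 0"
    using assms by (simp_all add: A B mat2_arith add_eq_0_iff)
  then have 2: "a * h = a * e + b * g + c * f" by (simp add: algebra_simps)
  show "fixes_or_inverts B A"
    unfolding fixes_or_inverts_def A B d mat2_arith using 2 by (simp add: algebra_simps)
  moreover have "adj2 A = - A" by (simp add: A d mat2_arith)
  ultimately show "fixes_or_inverts B (adj2 A)" by (simp add: fixes_or_inverts_minus)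
qed

lemma fixes_or_inverts_upper_lower_scalar:
  assumes "fixes_or_inverts M upper" "fixes_or_inverts M lower"
  shows "scalar M"
proof -
  obtain a b c d where M: "M = mat2 a b c d" by (rule mat2_exhaust)
  have double: "x = - x \<longleftrightarrow> x = 0" "- x = x \<longleftrightarrow> x = 0" "2 * x = 0 \<longleftrightarrow> x = 0" for x :: 5
    by (cases x rule: five_cases; simp)+
  have "c = 0 \<and> a = d" using assms(1) by (auto simp: fixes_or_inverts_def M mat2_arith double)
  moreover have "b = 0" using assms(2) by (auto simp: fixes_or_inverts_def M mat2_arith double)
  ultimately show ?thesis by (simp add: M scalar_def)
qed

text \<open>
  The homomorphism is arbitrary, so it is not enough to compare generating pairs with their reductions
  modulo 5. What is used is that the commutator of \<open>A\<close> and \<open>B\<close> is conjugate to that of \<open>ord2\<close> and \<open>ord3\<close>,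
  whose images are constrained by their orders.
\<close>

lemma no_generating_pair_over_upper_lower:
  assumes \<alpha>: "\<alpha> \<in> hom (PSL2 TYPE(int)) (PSL2 TYPE(5))"
    and gen: "generate (PSL2 TYPE(int)) {proj A, proj B} = carrier (PSL2 TYPE(int))"
    and det: "det A = 1" "det B = 1"
    and eq: "\<alpha> (proj A) = proj upper" "\<alpha> (proj B) = proj lower"
  shows False
proof -
  interpret \<alpha>: group_hom "PSL2 TYPE(int)" "PSL2 TYPE(5)" \<alpha>
    by (intro group_hom.intro group_hom_axioms.intro group_PSL2 \<alpha>)
  have det_ord: "det ord2 = 1" "det ord3 = 1" by (simp_all add: mat2_arith)
  have lift: "\<exists>m. det m = 1 \<and> \<alpha> (proj M) = proj m" if "det M = 1" for M
    using \<alpha>.hom_closed[OF proj_in_carrier[OF that]] by (auto simp: carrier_PSL2)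
  have hom_mult: "\<alpha> (proj (M ** N)) = proj (m ** n)"
    if "\<alpha> (proj M) = proj m" "\<alpha> (proj N) = proj n" "det M = 1" "det N = 1" for M N m n
    using \<alpha>.hom_mult[of "proj M" "proj N"] that by simp
  have inv: "\<alpha> (proj (adj2 M)) = proj (adj2 m)"
    if "\<alpha> (proj M) = proj m" "det M = 1" "det m = 1" for M m
    using \<alpha>.hom_inv[of "proj M"] that by simp
  have comm: "\<alpha> (proj (commutator M N)) = proj (commutator m n)"
    if "\<alpha> (proj M) = proj m" "\<alpha> (proj N) = proj n" "det M = 1" "det N = 1" "det m = 1" "det n = 1"
    for M N m n
    unfolding commutator_def by (intro hom_mult inv that) (simp_all add: that det_mul)
  obtain a where a: "det a = 1" "\<alpha> (proj ord2) = proj a" using lift[OF det_ord(1)] by blast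
  obtain b where b: "det b = 1" "\<alpha> (proj ord3) = proj b" using lift[OF det_ord(2)] by blast
  \<comment> \<open>The commutator of \<open>a\<close> and \<open>b\<close> is conjugate, up to sign, to that of \<open>upper\<close> and \<open>lower\<close>, because
    the commutators of their preimages both have trace 3.\<close>
  have trace_ab: "trace (commutator a b) = 1 \<or> trace (commutator a b) = - 1"
  proof -
    obtain p q r s where pqrs: "commutator A B = mat2 p q r s" by (rule mat2_exhaust)
    have "conjugate (commutator A B) (mat2 2 1 1 1)"
      unfolding pqrs
      using det_commutator[OF det] generating_pair_trace_commutator[OF gen det]
      by (intro trace_3_conjugate) (simp_all add: pqrs mat2_arith)
    also have "mat2 2 1 1 1 = commutator ord2 ord3"
      by (simp add: commutator_def mat2_arith)
    finally obtain X where X: "det X = 1" "commutator ord2 ord3 = X ** commutator A B ** adj2 X"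
      by (auto simp: conjugate_def)
    obtain x where x: "det x = 1" "\<alpha> (proj X) = proj x" using lift[OF X(1)] by blast
    have dets: "det upper = 1" "det lower = 1" by (simp_all add: mat2_arith)
    have "proj (commutator a b) = \<alpha> (proj (X ** commutator A B ** adj2 X))"
      using comm[OF a(2) b(2) det_ord a(1) b(1)] X(2) by simp
    also have "\<dots> = proj (x ** commutator upper lower ** adj2 x)"
      by (intro hom_mult inv comm x eq det dets) (simp_all add: X det_mul det_commutator det)
    finally have "trace (commutator a b) = trace (x ** commutator upper lower ** adj2 x) \<or>
        trace (commutator a b) = - trace (x ** commutator upper lower ** adj2 x)"
      unfolding proj_eq_iff using trace_minus by metis
    moreover have "trace (x ** commutator upper lower ** adj2 x) = trace (commutator upper lower)"
    proof -
      have "trace (x ** commutator upper lower ** adj2 x) = trace (adj2 x ** (x ** commutator upper lower))"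
        by (rule trace_mul_sym)
      then show ?thesis using x(1) by (simp add: matrix_mul_assoc adj2_inverse)
    qed
    moreover have "trace (commutator upper lower) = 1"
      by (simp add: commutator_def mat2_arith)
    ultimately show ?thesis by simp
  qed
  have noncommuting: "a ** b \<noteq> b ** a"
    using trace_ab trace_commutator_commuting[OF a(1) b(1)] by auto
  then have nonscalar: "\<not> scalar a" "\<not> scalar b"
    using scalar_commutes by metis+
  have "\<alpha> (proj (ord2 ** ord2)) = proj (a ** a)" by (intro hom_mult a det_ord)
  moreover have "proj (ord2 ** ord2) = \<one>\<^bsub>PSL2 TYPE(int)\<^esub>"
    by (simp add: proj_eq_one_iff mat2_arith)
  ultimately have "proj (a ** a) = \<one>\<^bsub>PSL2 TYPE(5)\<^esub>" by simp
  then have trace_a: "trace a = 0"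
    using square_scalar_imp nonscalar(1) by (auto simp: proj_eq_one_iff)
  have "\<alpha> (proj (ord3 ** ord3 ** ord3)) = proj (b ** b ** b)"
    by (intro hom_mult b det_ord) (simp add: det_mul det_ord)
  moreover have "proj (ord3 ** ord3 ** ord3) = \<one>\<^bsub>PSL2 TYPE(int)\<^esub>"
    by (simp add: proj_eq_one_iff mat2_arith)
  ultimately have "proj (b ** b ** b) = \<one>\<^bsub>PSL2 TYPE(5)\<^esub>" by simp
  then have trace_b: "(trace b)\<^sup>2 = 1"
    using cube_scalar_imp b(1) nonscalar(2) by (auto simp: proj_eq_one_iff)
  \<comment> \<open>The traces 0 and \<open>\<plusminus>1\<close> of \<open>a\<close> and \<open>b\<close> reduce the trace of the commutator to \<open>(trace (a b))\<^sup>2 - 1\<close>,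
    and 2 is not a square modulo 5.\<close>
  have "(trace (a ** b))\<^sup>2 - 1 = 1 \<or> (trace (a ** b))\<^sup>2 - 1 = - 1"
    using trace_ab trace_commutator[OF a(1) b(1)] trace_a trace_b by simp
  then have "trace (a ** b) = 0"
    by (cases "trace (a ** b)" rule: five_cases) simp_all
  note fixes_or_inverts_a = fixes_or_inverts_if_trace_0[OF trace_a this]
  \<comment> \<open>The image of \<open>\<alpha>\<close> is generated by the classes of \<open>a\<close> and \<open>b\<close>, which both fix or invert \<open>b\<close>.\<close>
  have "\<exists>m. \<alpha> (proj M) = proj m \<and> fixes_or_inverts b m" if "det M = 1" for M
    using PSL2_int_generate det_ord that
  proof (induction rule: PSL2_generate_induct)
    case one
    have "\<alpha> (proj (mat 1)) = proj (mat 1)" using \<alpha>.hom_one by (simp add: one_PSL2)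
    then show ?case using fixes_or_inverts_self by blast
  next
    case fst
    then show ?case using a fixes_or_inverts_a by blast
  next
    case snd
    then show ?case using b fixes_or_inverts_self by blast
  next
    case inv_fst
    then show ?case using inv[OF a(2) det_ord(1) a(1)] fixes_or_inverts_a by blast
  next
    case inv_snd
    then show ?case using inv[OF b(2) det_ord(2) b(1)] fixes_or_inverts_self by blast
  next
    case (minus X)
    then show ?case by simp
  next
    case (mult X Y)
    then show ?case using hom_mult fixes_or_inverts_mult by blast
  qed
  then have "\<exists>m. proj upper = proj m \<and> fixes_or_inverts b m" "\<exists>m. proj lower = proj m \<and> fixes_or_inverts b m"
    using eq det by metis+
  then have "fixes_or_inverts b upper" "fixes_or_inverts b lower"
    unfolding proj_eq_iff using fixes_or_inverts_minus by metis+
  with fixes_or_inverts_upper_lower_scalar nonscalar show False by blast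
qed

section \<open>Reduction modulo 5 and the negative example\<close>

definition reduce :: "int ^ 2 ^ 2 \<Rightarrow> 'a::comm_ring_1 ^ 2 ^ 2"
  where "reduce A = (\<chi> i j. of_int (A $ i $ j))"

lemma reduce_mat2: "reduce (mat2 a b c d) = mat2 (of_int a) (of_int b) (of_int c) (of_int d)"
  by (simp add: reduce_def vec_eq_iff forall_2)

lemma reduce_mult: "reduce (A ** B) = reduce A ** reduce B"
  by (rule mat2_exhaust[of A], rule mat2_exhaust[of B]) (simp add: reduce_mat2 mat2_arith)

lemma det_reduce: "det (reduce A) = of_int (det A)"
  by (rule mat2_exhaust[of A]) (simp add: reduce_mat2 mat2_arith)

lemma reduce_proj: "reduce ` proj A = proj (reduce A)"
  by (rule mat2_exhaust[of A]) (simp add: proj_def reduce_mat2 mat2_arith)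

lemma reduce_hom: "(`) reduce \<in> hom (PSL2 TYPE(int)) (PSL2 TYPE('a::comm_ring_1))"
proof (rule homI)
  fix g assume "g \<in> carrier (PSL2 TYPE(int))"
  then show "reduce ` g \<in> carrier (PSL2 TYPE('a))"
    by (auto simp: reduce_proj det_reduce simp del: image_subset_iff elim!: PSL2_exhaust)
next
  fix g h assume "g \<in> carrier (PSL2 TYPE(int))" "h \<in> carrier (PSL2 TYPE(int))"
  then obtain A B where "g = proj A" "h = proj B" by (meson PSL2_exhaust)
  then show "reduce ` (g \<otimes>\<^bsub>PSL2 TYPE(int)\<^esub> h) = reduce ` g \<otimes>\<^bsub>PSL2 TYPE('a)\<^esub> reduce ` h"
    by (simp add: reduce_proj reduce_mult)
qed

lemma reduce_5_surj: "(`) reduce ` carrier (PSL2 TYPE(int)) = carrier (PSL2 TYPE(5))"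
proof (rule PSL2_5_subgroup_eq)
  interpret group_hom "PSL2 TYPE(int)" "PSL2 TYPE(5)" "(`) reduce"
    by (intro group_hom.intro group_hom_axioms.intro group_PSL2 reduce_hom)
  show "subgroup ((`) reduce ` carrier (PSL2 TYPE(int))) (PSL2 TYPE(5))"
    by (rule subgroup_img_is_subgroup[OF G.subgroup_self])
  show "proj upper \<in> (`) reduce ` carrier (PSL2 TYPE(int))"
    by (rule image_eqI[of _ _ "proj (mat2 1 1 0 1)"]) (simp_all add: reduce_proj reduce_mat2 mat2_arith)
  show "proj lower \<in> (`) reduce ` carrier (PSL2 TYPE(int))"
    by (rule image_eqI[of _ _ "proj (mat2 1 0 2 1)"]) (simp_all add: reduce_proj reduce_mat2 mat2_arith)
qed

theorem corollary1p2:
  "let G = PSL2 TYPE(int);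
       H = PSL2 TYPE(5) \<times>\<times> (G Mod second_derived G)
   in neumann_negative_example 2 G H \<and> infinite (carrier H)"
proof -
  let ?G = "PSL2 TYPE(int)" and ?P = "PSL2 TYPE(5)"
  let ?Q = "?G Mod second_derived ?G" and ?q = "\<lambda>g. second_derived ?G #>\<^bsub>?G\<^esub> g"
  let ?H = "?P \<times>\<times> ?Q"
  interpret G: group ?G by (rule group_PSL2)
  interpret P: group ?P by (rule group_PSL2)
  interpret N: normal "second_derived ?G" ?G by (rule G.second_derived_normal)
  interpret Q: group ?Q by (rule N.factorgroup_is_group)
  interpret H: group ?H by (rule DirProd_group) unfold_locales
  interpret q: group_hom ?G ?Q ?q by unfold_locales (rule N.r_coset_hom_Mod)
  interpret fst: group_hom ?H ?P fst by unfold_locales (auto simp: hom_def)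
  interpret snd: group_hom ?H ?Q snd by unfold_locales (auto simp: hom_def)
  note subdirect = subdirect_perfect_metabelian[OF group_PSL2 Q.is_group PSL2_5_perfect
      G.second_derived_quotient]

  have "\<exists>gs. generating_tuple ?G 2 gs"
    using PSL2_int_generate
    by (intro exI[of _ "[proj ord2, proj ord3]"]) (simp add: generating_tuple_def mat2_arith(5))

  moreover have "epi ?G ?H \<noteq> {}"
  proof -
    let ?e = "\<lambda>g. (reduce ` g, ?q g)"
    have e: "?e \<in> hom ?G ?H"
      unfolding hom_paired using reduce_hom q.homh by blast
    then interpret e: group_hom ?G ?H ?e by unfold_locales
    have "?e ` carrier ?G = carrier ?H"
    proof (rule subdirect)
      show "subgroup (?e ` carrier ?G) ?H"
        by (rule e.subgroup_img_is_subgroup[OF G.subgroup_self])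
      show "fst ` ?e ` carrier ?G = carrier ?P"
        using reduce_5_surj by (simp add: image_image)
      show "snd ` ?e ` carrier ?G = carrier ?Q"
        by (simp add: image_image carrier_FactGroup)
    qed
    with e show ?thesis unfolding epi_def by blast
  qed

  moreover have "\<exists>hs. generating_tuple ?H 2 hs \<and>
    (\<forall>\<theta>\<in>hom ?G ?H. \<forall>gs. generating_tuple ?G 2 gs \<longrightarrow> map \<theta> gs \<noteq> hs)"
  proof (intro exI conjI ballI allI impI)
    \<comment> \<open>The second components can be any generating pair of the quotient; the obstruction lies in the
      first components.\<close>
    let ?h = "(proj upper, ?q (proj ord2))" and ?h' = "(proj lower, ?q (proj ord3))"
    have mem: "{?h, ?h'} \<subseteq> carrier ?H"
      by (auto simp: carrier_FactGroup mat2_arith(5))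
    have "generate ?H {?h, ?h'} = carrier ?H"
    proof (rule subdirect)
      show "subgroup (generate ?H {?h, ?h'}) ?H" by (rule H.generate_is_subgroup[OF mem])
      show "fst ` generate ?H {?h, ?h'} = carrier ?P"
        using fst.generate_img[OF mem] PSL2_5_generate by simp
      have "generate ?Q {?q (proj ord2), ?q (proj ord3)} = ?q ` carrier ?G"
        using q.generate_img[of "{proj ord2, proj ord3}"] PSL2_int_generate by (simp add: mat2_arith(5))
      then show "snd ` generate ?H {?h, ?h'} = carrier ?Q"
        using snd.generate_img[OF mem] by (simp add: carrier_FactGroup)
    qed
    with mem show "generating_tuple ?H 2 [?h, ?h']"
      by (simp add: generating_tuple_def)

    fix \<theta> gs assume \<theta>: "\<theta> \<in> hom ?G ?H" and gs: "generating_tuple ?G 2 gs"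
    from gs obtain g g' where g: "gs = [g, g']" "g \<in> carrier ?G" "g' \<in> carrier ?G"
      "generate ?G {g, g'} = carrier ?G"
      by (auto simp: generating_tuple_def numeral_2_eq_2 length_Suc_conv)
    obtain A B where AB: "det A = 1" "det B = 1" "g = proj A" "g' = proj B"
      using g(2,3) by (auto elim!: PSL2_exhaust)
    have hom: "fst \<circ> \<theta> \<in> hom ?G ?P" using \<theta> by (simp add: hom_pairwise)
    show "map \<theta> gs \<noteq> [?h, ?h']"
    proof
      assume "map \<theta> gs = [?h, ?h']"
      then have "(fst \<circ> \<theta>) (proj A) = proj upper" "(fst \<circ> \<theta>) (proj B) = proj lower"
        by (simp_all add: g AB)
      then show False using no_generating_pair_over_upper_lower[OF hom _ AB(1,2)] g(4) AB(3,4) by blast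
    qed
  qed

  moreover have "infinite (carrier ?H)"
    using infinite_PSL2_int_quotient P.carrier_not_empty Q.carrier_not_empty by (simp add: finite_cartesian_product_iff)

  ultimately show ?thesis
    using G.is_group H.is_group by (simp add: neumann_negative_example_def Let_def)
qed

end
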